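(* Let $(R,\mathfrak m,k)$ be an $F$-finite noetherian local ring of characteristic $p>0$, let $I$ be a proper ideal of $R$, and let $J$ be an $\mathfrak m$-primary ideal of $R$. Then $c^J(I)=r_{R,I,J}$ holds under any one of the following assumptions: (1) There exists a sequence of positive integers $r'_n$ such that $I^{r'_n}\subseteq J^{[p^n]}:(J^{[p^n]})^*$ for infinitely many $n$ and $\lim_n r'_n/p^n=0$. (2) There exists a constant $n_0$ such that $I^{n_0}\subseteq J^{[q]}:(J^{[q]})^*$ for infinitely many powers $q$ of $p$. (3) $R$ is $F$-rational, i.e. every parameter ideal coincides with its tight closure, and $J$ is a parameter ideal. (4) $I\subseteq\sqrt{\tau(R)}$, where $\tau(R)=\bigcap_{\mathfrak a\subseteq R}\mathfrak a:\mathfrak a^*$ (intersection over all ideals $\mathfrak a$ of $R$) is the test ideal of $R$. (5) $R$ is strongly $F$-regular on the punctured spectrum.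
   Context: $F$-finite means the Frobenius endomorphism is finite. $J^{[p^n]}$ is the ideal generated by the $p^n$-th powers of elements of $J$. The tight closure $\mathfrak a^*$ of an ideal $\mathfrak a$ is the ideal of all $x\in R$ for which there is $c\in R$, not in any minimal prime of $R$, with $cx^{p^n}\in\mathfrak a^{[p^n]}$ for all large $n$. The $F$-threshold is $c^J(I)=\lim_{n\to\infty}\frac1{p^n}\sup\{t\in\mathbb N: I^t\nsubseteq J^{[p^n]}\}$. The $F$-threshold up to tight closure is $r_{R,I,J}=\lim_{n\to\infty}\frac1{p^n}\max\{t\in\mathbb N: I^t\nsubseteq(J^{[p^n]})^*\}$. Both limits exist. *)

theory Defs
  imports Complex_Main "HOL-Library.Extended_Nat" "HOL-Algebra.Algebra"
begin

section \<open>Ideals of a commutative ring\<close>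

definition ideal_radical :: "('a, 'b) ring_scheme \<Rightarrow> 'a set \<Rightarrow> 'a set" where
  "ideal_radical R Q = {x \<in> carrier R. \<exists>n::nat. x [^]\<^bsub>R\<^esub> n \<in> Q}"

definition primary_ideal :: "('a, 'b) ring_scheme \<Rightarrow> 'a set \<Rightarrow> bool" where
  "primary_ideal R Q \<longleftrightarrow>
     ideal Q R \<and> Q \<noteq> carrier R \<and>
     (\<forall>x \<in> carrier R. \<forall>y \<in> carrier R.
        x \<otimes>\<^bsub>R\<^esub> y \<in> Q \<longrightarrow> x \<in> Q \<or> (\<exists>n::nat. y [^]\<^bsub>R\<^esub> n \<in> Q))"

definition primary_to :: "('a, 'b) ring_scheme \<Rightarrow> 'a set \<Rightarrow> 'a set \<Rightarrow> bool" where
  "primary_to R \<mm> Q \<longleftrightarrow> primary_ideal R Q \<and> ideal_radical R Q = \<mm>"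

definition colon_ideal :: "('a, 'b) ring_scheme \<Rightarrow> 'a set \<Rightarrow> 'a set \<Rightarrow> 'a set" where
  "colon_ideal R A B = {r \<in> carrier R. \<forall>x \<in> B. r \<otimes>\<^bsub>R\<^esub> x \<in> A}"

primrec ideal_power :: "('a, 'b) ring_scheme \<Rightarrow> 'a set \<Rightarrow> nat \<Rightarrow> 'a set" where
  "ideal_power R A 0 = carrier R"
| "ideal_power R A (Suc n) = ideal_prod R (ideal_power R A n) A"

definition minimal_prime :: "('a, 'b) ring_scheme \<Rightarrow> 'a set \<Rightarrow> bool" where
  "minimal_prime R P \<longleftrightarrow>
     primeideal P R \<and> (\<forall>Q. primeideal Q R \<and> Q \<subseteq> P \<longrightarrow> Q = P)"

definition off_minimal_primes :: "('a, 'b) ring_scheme \<Rightarrow> 'a set" where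
  "off_minimal_primes R = {c \<in> carrier R. \<forall>P. minimal_prime R P \<longrightarrow> c \<notin> P}"

definition local_ring :: "('a, 'b) ring_scheme \<Rightarrow> 'a set \<Rightarrow> bool" where
  "local_ring R \<mm> \<longleftrightarrow>
     cring R \<and> maximalideal \<mm> R \<and> (\<forall>M. maximalideal M R \<longrightarrow> M = \<mm>)"


section \<open>Dimension and parameters\<close>

definition krull_dim :: "('a, 'b) ring_scheme \<Rightarrow> enat" where
  "krull_dim R = Sup {enat n | n. \<exists>P :: nat \<Rightarrow> 'a set.
     (\<forall>i \<le> n. primeideal (P i) R) \<and> (\<forall>i < n. P i \<subset> P (Suc i))}"

definition system_of_parameters :: "('a, 'b) ring_scheme \<Rightarrow> 'a set \<Rightarrow> 'a list \<Rightarrow> bool" where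
  "system_of_parameters R \<mm> xs \<longleftrightarrow>
     set xs \<subseteq> \<mm> \<and> enat (length xs) = krull_dim R \<and> primary_to R \<mm> (Idl\<^bsub>R\<^esub> (set xs))"

definition parameter_ideal :: "('a, 'b) ring_scheme \<Rightarrow> 'a set \<Rightarrow> 'a set \<Rightarrow> bool" where
  "parameter_ideal R \<mm> Q \<longleftrightarrow>
     (\<exists>xs ys. system_of_parameters R \<mm> (xs @ ys) \<and> Q = Idl\<^bsub>R\<^esub> (set xs))"


section \<open>Localization\<close>

text \<open>Fractions \<open>a/s\<close> are classes of pairs in \<open>carrier R \<times> S\<close>, for a multiplicative set \<open>S\<close>.\<close>

definition fraction_rel ::
  "('a, 'b) ring_scheme \<Rightarrow> 'a set \<Rightarrow> (('a \<times> 'a) \<times> ('a \<times> 'a)) set" where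
  "fraction_rel R S = {((a, s), (b, t)).
     a \<in> carrier R \<and> s \<in> S \<and> b \<in> carrier R \<and> t \<in> S \<and>
     (\<exists>u \<in> S. u \<otimes>\<^bsub>R\<^esub> (a \<otimes>\<^bsub>R\<^esub> t) = u \<otimes>\<^bsub>R\<^esub> (b \<otimes>\<^bsub>R\<^esub> s))}"

definition fraction :: "('a, 'b) ring_scheme \<Rightarrow> 'a set \<Rightarrow> 'a \<Rightarrow> 'a \<Rightarrow> ('a \<times> 'a) set" where
  "fraction R S a s = fraction_rel R S `` {(a, s)}"

definition localization :: "('a, 'b) ring_scheme \<Rightarrow> 'a set \<Rightarrow> ('a \<times> 'a) set ring" where
  "localization R S = \<lparr>
     carrier = (carrier R \<times> S) // fraction_rel R S,
     monoid.mult = (\<lambda>z w. \<Union>(a, s) \<in> z. \<Union>(b, t) \<in> w. fraction R S (a \<otimes>\<^bsub>R\<^esub> b) (s \<otimes>\<^bsub>R\<^esub> t)),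
     monoid.one = fraction R S \<one>\<^bsub>R\<^esub> \<one>\<^bsub>R\<^esub>,
     ring.zero = fraction R S \<zero>\<^bsub>R\<^esub> \<one>\<^bsub>R\<^esub>,
     ring.add = (\<lambda>z w. \<Union>(a, s) \<in> z. \<Union>(b, t) \<in> w.
       fraction R S (a \<otimes>\<^bsub>R\<^esub> t \<oplus>\<^bsub>R\<^esub> b \<otimes>\<^bsub>R\<^esub> s) (s \<otimes>\<^bsub>R\<^esub> t))\<rparr>"

abbreviation localization_at :: "('a, 'b) ring_scheme \<Rightarrow> 'a set \<Rightarrow> ('a \<times> 'a) set ring" where
  "localization_at R P \<equiv> localization R (carrier R - P)"


section \<open>Characteristic p\<close>

definition has_characteristic :: "('a, 'b) ring_scheme \<Rightarrow> nat \<Rightarrow> bool" where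
  "has_characteristic R p \<longleftrightarrow> (\<forall>n::nat. add_pow R n \<one>\<^bsub>R\<^esub> = \<zero>\<^bsub>R\<^esub> \<longleftrightarrow> p dvd n)"

text \<open>Finiteness of the Frobenius: the ring is finitely generated as a module over itself,
  where \<open>r\<close> acts as multiplication by \<open>r\<^sup>p\<close>.\<close>

definition F_finite :: "('a, 'b) ring_scheme \<Rightarrow> nat \<Rightarrow> bool" where
  "F_finite R p \<longleftrightarrow>
     (\<exists>B. finite B \<and> B \<subseteq> carrier R \<and>
        (\<forall>x \<in> carrier R. \<exists>r \<in> B \<rightarrow> carrier R.
           x = finsum R (\<lambda>b. r b [^]\<^bsub>R\<^esub> p \<otimes>\<^bsub>R\<^esub> b) B))"

text \<open>The argument \<open>q\<close> is the exponent itself, a power of \<open>p\<close>.\<close>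

definition frobenius_power :: "('a, 'b) ring_scheme \<Rightarrow> 'a set \<Rightarrow> nat \<Rightarrow> 'a set" where
  "frobenius_power R A q = Idl\<^bsub>R\<^esub> ((\<lambda>x. x [^]\<^bsub>R\<^esub> q) ` A)"

definition tight_closure :: "('a, 'b) ring_scheme \<Rightarrow> nat \<Rightarrow> 'a set \<Rightarrow> 'a set" where
  "tight_closure R p A = {x \<in> carrier R. \<exists>c \<in> off_minimal_primes R.
     \<forall>\<^sub>F n in sequentially. c \<otimes>\<^bsub>R\<^esub> x [^]\<^bsub>R\<^esub> (p ^ n) \<in> frobenius_power R A (p ^ n)}"

definition test_ideal :: "('a, 'b) ring_scheme \<Rightarrow> nat \<Rightarrow> 'a set" where
  "test_ideal R p = \<Inter>{colon_ideal R A (tight_closure R p A) | A. ideal A R}"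

definition F_rational :: "('a, 'b) ring_scheme \<Rightarrow> 'a set \<Rightarrow> nat \<Rightarrow> bool" where
  "F_rational R \<mm> p \<longleftrightarrow> (\<forall>Q. parameter_ideal R \<mm> Q \<longrightarrow> Q = tight_closure R p Q)"

text \<open>For F-finite \<open>R\<close>: for every \<open>c\<close> off the minimal primes there is \<open>e > 0\<close> such that the
  \<open>R\<close>-linear map \<open>R \<rightarrow> F\<^sup>e\<^sub>*R\<close>, \<open>1 \<mapsto> F\<^sup>e\<^sub>*c\<close>, splits. Here \<open>F\<^sup>e\<^sub>*R\<close> is \<open>R\<close> with \<open>r\<close> acting as
  multiplication by the \<open>p\<^sup>e\<close>-th power of \<open>r\<close>, and \<open>\<phi>\<close> is the splitting. The condition \<open>e > 0\<close>
  cannot be dropped: with \<open>e = 0\<close> allowed, every Artinian local ring would qualify.\<close>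

definition strongly_F_regular :: "('a, 'b) ring_scheme \<Rightarrow> nat \<Rightarrow> bool" where
  "strongly_F_regular R p \<longleftrightarrow>
     (\<forall>c \<in> off_minimal_primes R. \<exists>e > 0. \<exists>\<phi> \<in> carrier R \<rightarrow> carrier R.
        (\<forall>x \<in> carrier R. \<forall>y \<in> carrier R. \<phi> (x \<oplus>\<^bsub>R\<^esub> y) = \<phi> x \<oplus>\<^bsub>R\<^esub> \<phi> y) \<and>
        (\<forall>r \<in> carrier R. \<forall>x \<in> carrier R.
           \<phi> (r [^]\<^bsub>R\<^esub> (p ^ e) \<otimes>\<^bsub>R\<^esub> x) = r \<otimes>\<^bsub>R\<^esub> \<phi> x) \<and>
        \<phi> c = \<one>\<^bsub>R\<^esub>)"

definition strongly_F_regular_on_punctured_spectrum ::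
  "('a, 'b) ring_scheme \<Rightarrow> 'a set \<Rightarrow> nat \<Rightarrow> bool" where
  "strongly_F_regular_on_punctured_spectrum R \<mm> p \<longleftrightarrow>
     (\<forall>P. primeideal P R \<and> P \<noteq> \<mm> \<longrightarrow> strongly_F_regular (localization_at R P) p)"


section \<open>Thresholds\<close>

text \<open>Both are meant for a proper ideal \<open>I\<close> and an ideal \<open>J\<close> primary to the maximal ideal of a
  noetherian local ring. Then the sets of exponents are finite and nonempty (\<open>I\<^sup>0 = R\<close>), so \<open>Sup\<close>
  and \<open>Max\<close> over \<open>nat\<close> take their usual values, and both limits exist.\<close>

definition F_threshold :: "('a, 'b) ring_scheme \<Rightarrow> nat \<Rightarrow> 'a set \<Rightarrow> 'a set \<Rightarrow> real" where
  "F_threshold R p J I =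
     lim (\<lambda>n. real (Sup {t. \<not> ideal_power R I t \<subseteq> frobenius_power R J (p ^ n)}) / real (p ^ n))"

definition F_threshold_tight :: "('a, 'b) ring_scheme \<Rightarrow> nat \<Rightarrow> 'a set \<Rightarrow> 'a set \<Rightarrow> real" where
  "F_threshold_tight R p I J =
     lim (\<lambda>n. real (Max {t. \<not> ideal_power R I t \<subseteq>
                            tight_closure R p (frobenius_power R J (p ^ n))}) / real (p ^ n))"

end

(* With N(n) the least t such that I^t is contained in the Frobenius power T_n = J^[p^n], monomials
   in generators of I show N(n+1) <= p (N(n) + C), so N(n)/p^n converges; the same holds for the
   tight closures of the T_n. If I^(r n) multiplies the tight closure of T_n into T_n, the two
   exponents differ by at most r n, so both limits agree as soon as r n = o(p^n) along a
   subsequence. Under (2)-(4) a constant r works. Under (5) every f in the maximal ideal has a power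
   in the test ideal, which reduces to (4): at a prime P not containing f the local splittings lift,
   up to a denominator, to maps F^e_* R -> R, because R is F-finite and the kernel of R -> R_P is
   finitely generated; a power of f is then a uniform test element by the argument of Hochster
   and Huneke. *)

theory Submission
  imports Defs
begin

section \<open>Ideals and their powers\<close>

text \<open>The obstacle in case (5) is uniformity. For x in the tight closure of A, local
  splittings yield a power f^N that multiplies x^q into A^[q] for all large q, but N depends on x
  and A, while the test ideal asks for one power that serves all of them. One map F_*R -> R with
  value c, a positive power of f, at 1 repairs this: twisted composition turns it into maps F^e_*R
  -> R with value c^2 at 1 for every e. For large q = p^e the element c^q absorbs f^N, so (c x)^q
  lies in A^[q], and extracting the q-th root costs only c^2; hence c^3 x lies in A. Local
  information is glued through ideals: the multipliers of a given x, and the values at 1 of maps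
  F_*R -> R, form ideals, and an ideal contains a power of f as soon as no prime missing f contains
  it. The recursion for the exponents is one-sided, but it already makes a corrected scaled sequence
  decreasing. Convergence of both sequences is what allows infinitely many n to decide the
  equality.\<close>

lemma pigeonhole_count_list:
  assumes "finite G" "set xs \<subseteq> G" "card G * k < length xs"
  obtains x where "x \<in> G" "Suc k \<le> count_list xs x"
proof -
  have "\<exists>x\<in>G. Suc k \<le> count_list xs x"
  proof (rule ccontr)
    assume "\<not> ?thesis"
    then have "\<forall>x\<in>G. count_list xs x \<le> k"
      by (simp add: not_le less_Suc_eq_le)
    then have "(\<Sum>x\<in>G. count_list xs x) \<le> (\<Sum>x\<in>G. k)"
      by (intro sum_mono) simp
    then show False
      using sum_count_set[OF assms(2,1)] assms(3) by simp
  qed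
  then show thesis using that by blast
qed

context cring
begin

lemma ideal_by_closure:
  assumes "I \<subseteq> carrier R" "\<zero> \<in> I"
    and add: "\<And>x y. \<lbrakk>x \<in> I; y \<in> I\<rbrakk> \<Longrightarrow> x \<oplus> y \<in> I"
    and mult: "\<And>r x. \<lbrakk>r \<in> carrier R; x \<in> I\<rbrakk> \<Longrightarrow> r \<otimes> x \<in> I"
  shows "ideal I R"
proof (rule idealI)
  show "ring R" by (rule ring_axioms)
  have "\<ominus> x \<in> I" if "x \<in> I" for x
  proof -
    have "x \<in> carrier R" using that assms(1) by blast
    then show ?thesis using mult[OF _ that, of "\<ominus> \<one>"] by (simp add: l_minus)
  qed
  then show "subgroup I (add_monoid R)"
    using assms(1-3) by (intro add.subgroupI) (simp_all add: a_inv_def, blast)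
  fix a x assume ax: "a \<in> I" "x \<in> carrier R"
  then show "x \<otimes> a \<in> I" by (intro mult)
  then show "a \<otimes> x \<in> I" using ax assms(1) m_comm[of a x] by (simp add: subset_iff)
qed

lemma ideal_closed:
  assumes "ideal I R"
  shows "I \<subseteq> carrier R" "\<zero> \<in> I"
    and "\<And>x y. \<lbrakk>x \<in> I; y \<in> I\<rbrakk> \<Longrightarrow> x \<oplus> y \<in> I"
    and "\<And>r x. \<lbrakk>r \<in> carrier R; x \<in> I\<rbrakk> \<Longrightarrow> r \<otimes> x \<in> I"
    and "\<And>r x. \<lbrakk>r \<in> carrier R; x \<in> I\<rbrakk> \<Longrightarrow> x \<otimes> r \<in> I"
  proof -
  interpret ideal I R by fact
  show "I \<subseteq> carrier R" "\<zero> \<in> I"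
    and "\<And>x y. \<lbrakk>x \<in> I; y \<in> I\<rbrakk> \<Longrightarrow> x \<oplus> y \<in> I"
    and "\<And>r x. \<lbrakk>r \<in> carrier R; x \<in> I\<rbrakk> \<Longrightarrow> r \<otimes> x \<in> I"
    and "\<And>r x. \<lbrakk>r \<in> carrier R; x \<in> I\<rbrakk> \<Longrightarrow> x \<otimes> r \<in> I"
    by (auto simp: I_l_closed I_r_closed)
qed

lemma ideal_colon:
  assumes "ideal A R" "B \<subseteq> carrier R"
  shows "ideal (colon_ideal R A B) R"
  unfolding colon_ideal_def
proof (rule ideal_by_closure)
  note A = ideal_closed[OF assms(1)]
  show "\<zero> \<in> {r \<in> carrier R. \<forall>x\<in>B. r \<otimes> x \<in> A}"
    using A(2) assms(2) by auto
  show "x \<oplus> y \<in> {r \<in> carrier R. \<forall>x\<in>B. r \<otimes> x \<in> A}"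
    if "x \<in> {r \<in> carrier R. \<forall>x\<in>B. r \<otimes> x \<in> A}" "y \<in> {r \<in> carrier R. \<forall>x\<in>B. r \<otimes> x \<in> A}" for x y
    using that assms(2) A(3) by (auto simp: l_distr subset_iff)
  show "r \<otimes> x \<in> {r \<in> carrier R. \<forall>x\<in>B. r \<otimes> x \<in> A}"
    if "r \<in> carrier R" "x \<in> {r \<in> carrier R. \<forall>x\<in>B. r \<otimes> x \<in> A}" for r x
    using that assms(2) A(4) by (auto simp: m_assoc subset_iff)
qed auto

lemma ideal_ideal_power: "ideal I R \<Longrightarrow> ideal (ideal_power R I n) R"
  by (induction n) (auto simp: oneideal ideal_prod_is_ideal)

lemma ideal_power_antimono:
  assumes "ideal I R" "m \<le> n"
  shows "ideal_power R I n \<subseteq> ideal_power R I m"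
  using assms(2)
proof (induction n rule: dec_induct)
  case (step n)
  then show ?case
    using ideal_prod_inter[OF ideal_ideal_power[OF assms(1)] assms(1), of n] by auto
qed simp

lemma ideal_power_add:
  assumes "ideal I R"
  shows "ideal_power R I (m + n) = ideal_prod R (ideal_power R I m) (ideal_power R I n)"
  by (induction n)
    (simp_all add: assms ideal_ideal_power ideal_prod_one ideal_prod_assoc)

lemma ideal_prod_subset_iff:
  assumes "ideal T R"
  shows "ideal_prod R A B \<subseteq> T \<longleftrightarrow> (\<forall>a\<in>A. \<forall>b\<in>B. a \<otimes> b \<in> T)"
proof
  assume ab: "\<forall>a\<in>A. \<forall>b\<in>B. a \<otimes> b \<in> T"
  show "ideal_prod R A B \<subseteq> T"
  proof
    fix s assume "s \<in> ideal_prod R A B"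
    then show "s \<in> T"
      by (induction rule: ideal_prod.induct) (use ab ideal_closed[OF assms] in auto)
  qed
qed (auto intro: ideal_prod.prod)

text \<open>The comparison of exponents rests on I^(r+s) = I^r I^s, which lies in (T : B) B. It is
  applied with B the tight closure of T.\<close>

lemma ideal_power_colon:
  assumes "ideal I R" "ideal T R" "ideal_power R I s \<subseteq> B" "ideal_power R I r \<subseteq> colon_ideal R T B"
  shows "ideal_power R I (r + s) \<subseteq> T"
  unfolding ideal_power_add[OF assms(1)]
  using assms(3,4) by (auto simp: ideal_prod_subset_iff[OF assms(2)] colon_ideal_def)

lemma foldr_mult_closed: "set xs \<subseteq> carrier R \<Longrightarrow> foldr (\<otimes>) xs \<one> \<in> carrier R"
  by (induction xs) auto

lemma foldr_mult_append:
  assumes "set xs \<subseteq> carrier R" "set ys \<subseteq> carrier R"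
  shows "foldr (\<otimes>) (xs @ ys) \<one> = foldr (\<otimes>) xs \<one> \<otimes> foldr (\<otimes>) ys \<one>"
  using assms by (induction xs) (auto simp: foldr_mult_closed m_assoc simp del: foldr_append)

text \<open>Lists stand for monomials in the generators. The clause on \<open>count_list\<close>
  serves the induction, which must know that a further copy of x is left.\<close>

lemma foldr_mult_extract:
  assumes "set xs \<subseteq> carrier R" "k \<le> count_list xs x"
  shows "\<exists>ys. set ys \<subseteq> set xs \<and> length xs = k + length ys \<and> count_list xs x = k + count_list ys x \<and>
    foldr (\<otimes>) xs \<one> = x [^] k \<otimes> foldr (\<otimes>) ys \<one>"
  using assms(2)
proof (induction k)
  case 0
  then show ?case using assms(1) foldr_mult_closed by (intro exI[of _ xs]) simp
next
  case (Suc k)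
  then obtain ys where ys: "set ys \<subseteq> set xs" "length xs = k + length ys"
    "count_list xs x = k + count_list ys x"
    "foldr (\<otimes>) xs \<one> = x [^] k \<otimes> foldr (\<otimes>) ys \<one>"
    by auto
  with Suc.prems have "x \<in> set ys"
    using count_list_0_iff[of ys x] by linarith
  then obtain as bs where ab: "ys = as @ x # bs"
    using split_list by metis
  then have c: "set as \<subseteq> carrier R" "set bs \<subseteq> carrier R" "x \<in> carrier R"
    using assms(1) ys(1) by auto
  have "foldr (\<otimes>) ys \<one> = foldr (\<otimes>) as \<one> \<otimes> (x \<otimes> foldr (\<otimes>) bs \<one>)"
    using c foldr_mult_append[of as "x # bs"] by (auto simp: ab)
  also have "\<dots> = x \<otimes> foldr (\<otimes>) (as @ bs) \<one>"
    using c foldr_mult_closed by (simp add: foldr_mult_append m_lcomm del: foldr_append)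
  finally have "foldr (\<otimes>) xs \<one> = x [^] Suc k \<otimes> foldr (\<otimes>) (as @ bs) \<one>"
    using ys(4) c foldr_mult_closed[of "as @ bs"] by (simp add: m_assoc)
  then show ?case
    using ys c ab by (intro exI[of _ "as @ bs"]) auto
qed

text \<open>The monomials of degree n generate the n-th power. The induction treats all targets T at
  once, because splitting off a generator x replaces T by the colon ideal T : x.\<close>

lemma ideal_power_genideal_subset:
  assumes "G \<subseteq> carrier R" "ideal T R"
    and "\<And>xs. \<lbrakk>set xs \<subseteq> G; length xs = n\<rbrakk> \<Longrightarrow> foldr (\<otimes>) xs \<one> \<in> T"
  shows "ideal_power R (Idl G) n \<subseteq> T"
  using assms(2,3)
proof (induction n arbitrary: T)
  case 0
  then show ?case
    using ideal.one_imp_carrier[of T R] by simp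
next
  case (Suc n)
  note T = ideal_closed[OF Suc.prems(1)]
  let ?P = "ideal_power R (Idl G) n"
  have P: "?P \<subseteq> carrier R"
    using ideal_closed(1)[OF ideal_ideal_power[OF genideal_ideal[OF assms(1)]]] .
  have "G \<subseteq> colon_ideal R T ?P"
  proof
    fix x assume x: "x \<in> G"
    then have xc: "x \<in> carrier R" using assms(1) by auto
    have "?P \<subseteq> colon_ideal R T {x}"
    proof (rule Suc.IH)
      show "ideal (colon_ideal R T {x}) R"
        using Suc.prems(1) xc by (intro ideal_colon) auto
      fix xs assume xs: "set xs \<subseteq> G" "length xs = n"
      have "foldr (\<otimes>) xs \<one> \<in> carrier R"
        using xs assms(1) by (intro foldr_mult_closed) auto
      then show "foldr (\<otimes>) xs \<one> \<in> colon_ideal R T {x}"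
        using Suc.prems(2)[of "x # xs"] xs x xc by (simp add: colon_ideal_def m_comm)
    qed
    then show "x \<in> colon_ideal R T ?P"
      using xc P by (auto simp: colon_ideal_def subset_iff m_comm)
  qed
  then have "Idl G \<subseteq> colon_ideal R T ?P"
    using ideal_colon[OF Suc.prems(1) P] by (rule genideal_minimal[rotated])
  then have "a \<otimes> b \<in> T" if "a \<in> ?P" "b \<in> Idl G" for a b
    using that P m_comm[of a b] by (auto simp: colon_ideal_def subset_iff)
  then show ?case
    by (auto simp: ideal_prod_subset_iff[OF Suc.prems(1)])
qed

lemma genideal_power_subset_of_radical:
  assumes "finite G" "G \<subseteq> carrier R" "ideal T R" "G \<subseteq> ideal_radical R T"
  obtains N where "ideal_power R (Idl G) N \<subseteq> T"
proof -
  note T = ideal_closed[OF assms(3)]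
  have "\<forall>x\<in>G. \<exists>n::nat. x [^] n \<in> T"
    using assms(4) by (auto simp: ideal_radical_def)
  then obtain n :: "'a \<Rightarrow> nat" where n: "\<And>x. x \<in> G \<Longrightarrow> x [^] n x \<in> T"
    by metis
  \<comment> \<open>The sum bounds every single \<open>n x\<close>, also when G is empty. A monomial
    of degree \<open>card G * k + 1\<close> then contains some generator at least k + 1
    times.\<close>
  define k where "k = (\<Sum>x\<in>G. n x)"
  have k: "x [^] Suc k \<in> T" if "x \<in> G" for x
  proof -
    have "n x \<le> k"
      using assms(1) that by (simp add: k_def member_le_sum)
    then have "x [^] Suc k = x [^] (Suc k - n x) \<otimes> x [^] n x"
      using that assms(2) by (subst nat_pow_mult) auto
    then show ?thesis
      using T(4) n[OF that] that assms(2) by auto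
  qed
  have "ideal_power R (Idl G) (card G * k + 1) \<subseteq> T"
  proof (rule ideal_power_genideal_subset[OF assms(2,3)])
    fix xs assume xs: "set xs \<subseteq> G" "length xs = card G * k + 1"
    then obtain x where x: "x \<in> G" "Suc k \<le> count_list xs x"
      using pigeonhole_count_list[OF assms(1) xs(1), of k] by auto
    have c: "set xs \<subseteq> carrier R" using xs assms(2) by auto
    obtain ys where ys: "set ys \<subseteq> set xs"
      "foldr (\<otimes>) xs \<one> = x [^] Suc k \<otimes> foldr (\<otimes>) ys \<one>"
      using foldr_mult_extract[OF c x(2)] by blast
    have "foldr (\<otimes>) ys \<one> \<in> carrier R"
      using ys c by (intro foldr_mult_closed) auto
    then show "foldr (\<otimes>) xs \<one> \<in> T"
      unfolding ys(2) using T(5) k[OF x(1)] by blast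
  qed
  then show thesis by (rule that)
qed

section \<open>Frobenius powers\<close>

lemma ideal_frobenius_power: "A \<subseteq> carrier R \<Longrightarrow> ideal (frobenius_power R A q) R"
  unfolding frobenius_power_def by (intro genideal_ideal) auto

lemma pow_in_frobenius_power:
  "\<lbrakk>A \<subseteq> carrier R; a \<in> A\<rbrakk> \<Longrightarrow> a [^] q \<in> frobenius_power R A q"
  unfolding frobenius_power_def
  using genideal_self[of "(\<lambda>x. x [^] q) ` A"] by auto

lemma frobenius_power_subset_iff:
  assumes "A \<subseteq> carrier R" "ideal T R"
  shows "frobenius_power R A q \<subseteq> T \<longleftrightarrow> (\<forall>a\<in>A. a [^] q \<in> T)"
proof
  assume "\<forall>a\<in>A. a [^] q \<in> T"
  then show "frobenius_power R A q \<subseteq> T"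
    unfolding frobenius_power_def using assms by (intro genideal_minimal) auto
qed (use pow_in_frobenius_power[OF assms(1)] in auto)

lemma frobenius_power_mono:
  assumes "A \<subseteq> B" "B \<subseteq> carrier R"
  shows "frobenius_power R A q \<subseteq> frobenius_power R B q"
  using assms pow_in_frobenius_power[OF assms(2)]
  by (subst frobenius_power_subset_iff) (auto intro: ideal_frobenius_power)

text \<open>A monomial of degree at least \<open>q (t + \<mu>)\<close> in \<open>\<mu>\<close> variables contains, with multiplicity,
  \<open>t\<close> factors that are \<open>q\<close>-th powers of a variable.\<close>

lemma ideal_power_subset_frobenius_power:
  assumes "finite G" "G \<subseteq> carrier R" "q > 0"
  shows "ideal_power R (Idl G) (q * (t + card G)) \<subseteq> frobenius_power R (ideal_power R (Idl G) t) q"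
proof -
  let ?I = "ideal_power R (Idl G)"
  have I: "?I t \<subseteq> carrier R" for t
    using ideal_closed(1)[OF ideal_ideal_power[OF genideal_ideal[OF assms(2)]]] .
  have "foldr (\<otimes>) xs \<one> \<in> frobenius_power R (?I t) q"
    if "set xs \<subseteq> G" "q * (t + card G) \<le> length xs" for t xs
    using that
  proof (induction t arbitrary: xs)
    case 0
    have "\<one> [^] q \<in> frobenius_power R (carrier R) q"
      by (intro pow_in_frobenius_power) auto
    then have "frobenius_power R (carrier R) q = carrier R"
      using ideal.one_imp_carrier[OF ideal_frobenius_power] by simp
    then show ?case
      using 0 assms(2) foldr_mult_closed[of xs] by auto
  next
    case (Suc t)
    have c: "set xs \<subseteq> carrier R" using Suc.prems assms(2) by auto
    \<comment> \<open>The degree exceeds \<open>card G * (q - 1)\<close>, so some generator occurs q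
      times. Removing these q copies leaves the degree needed for t.\<close>
    have "card G * (q - 1) \<le> q * card G" by (simp add: mult.commute diff_le_self)
    also have "\<dots> < q * (Suc t + card G)" using assms(3) by (simp add: distrib_left)
    finally obtain x where x: "x \<in> G" "q \<le> count_list xs x"
      using pigeonhole_count_list[OF assms(1) Suc.prems(1), of "q - 1"] Suc.prems(2) assms(3)
      by (metis Suc_diff_1 order_less_le_trans)
    then have xc: "x \<in> carrier R" using assms(2) by auto
    obtain ys where ys: "set ys \<subseteq> set xs" "length xs = q + length ys"
      "foldr (\<otimes>) xs \<one> = x [^] q \<otimes> foldr (\<otimes>) ys \<one>"
      using foldr_mult_extract[OF c x(2)] by blast
    let ?T = "frobenius_power R (?I (Suc t)) q"
    \<comment> \<open>The colon ideal reduces the claim to generators a^q with a in I^t, where a^q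
      x^q = (a x)^q and a x lies in I^(t+1).\<close>
    have "frobenius_power R (?I t) q \<subseteq> colon_ideal R ?T {x [^] q}"
    proof (subst frobenius_power_subset_iff[OF I])
      show "ideal (colon_ideal R ?T {x [^] q}) R"
        using xc I by (intro ideal_colon ideal_frobenius_power) (auto simp del: ideal_power.simps)
      show "\<forall>a\<in>?I t. a [^] q \<in> colon_ideal R ?T {x [^] q}"
      proof
        fix a assume a: "a \<in> ?I t"
        then have "a \<otimes> x \<in> ?I (Suc t)"
          using x(1) genideal_self[OF assms(2)] by (auto intro: ideal_prod.prod)
        then have "(a \<otimes> x) [^] q \<in> ?T"
          by (intro pow_in_frobenius_power I)
        then show "a [^] q \<in> colon_ideal R ?T {x [^] q}"
          using a I[of t] xc by (auto simp: colon_ideal_def nat_pow_distrib)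
      qed
    qed
    moreover have "foldr (\<otimes>) ys \<one> \<in> frobenius_power R (?I t) q"
      using ys Suc.prems by (intro Suc.IH) auto
    ultimately have "foldr (\<otimes>) ys \<one> \<otimes> x [^] q \<in> ?T"
      by (auto simp: colon_ideal_def)
    then show ?case
      using ys c xc foldr_mult_closed[of ys] by (auto simp: m_comm)
  qed
  then show ?thesis
    by (intro ideal_power_genideal_subset[OF assms(2) ideal_frobenius_power[OF I]]) auto
qed

end

section \<open>Additivity of the Frobenius\<close>

context cring
begin

lemma binomial_expansion:
  assumes "x \<in> carrier R" "y \<in> carrier R"
  shows "(x \<oplus> y) [^] n = (\<Oplus>k\<in>{..n}. add_pow R (n choose k) (x [^] k \<otimes> y [^] (n - k)))"
proof (induction n)
  case 0
  then show ?case using assms by simp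
next
  case (Suc n)
  \<comment> \<open>With the coefficient and both exponents independent, multiplication by x or y is
    an index shift, and Pascal's rule is additivity in the coefficient.\<close>
  define t where "t = (\<lambda>m k l. add_pow R (m::nat) (x [^] (k::nat) \<otimes> y [^] (l::nat)))"
  have c [simp]: "t m k l \<in> carrier R" for m k l
    using assms by (simp add: t_def)
  have tx: "t m k l \<otimes> x = t m (Suc k) l" for m k l
    using assms m_comm[of "y [^] l" x] by (simp add: t_def add_pow_ldistr m_assoc)
  have ty: "t m k l \<otimes> y = t m k (Suc l)" for m k l
    using assms by (simp add: t_def add_pow_ldistr m_assoc)
  have tadd: "t (m + m') k l = t m k l \<oplus> t m' k l" for m m' k l
    using assms by (simp add: t_def add.nat_pow_mult)
  have t0: "t 0 k l = \<zero>" for k l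
    by (simp add: t_def)
  have ty1: "t 1 0 l = y [^] l" for l
    using assms by (simp add: t_def)
  let ?S = "\<Oplus>k\<in>{..n}. t (n choose k) k (n - k)"
  have x: "?S \<otimes> x = (\<Oplus>k\<in>{..n}. t (n choose k) (Suc k) (n - k))"
    using assms by (subst finsum_ldistr) (simp_all add: tx)
  have "?S \<otimes> y = (\<Oplus>k\<in>{..n}. t (n choose k) k (Suc (n - k)))"
    using assms by (subst finsum_ldistr) (simp_all add: ty)
  also have "\<dots> = (\<Oplus>k\<in>{..n}. t (n choose k) k (Suc n - k))"
    by (rule finsum_cong') (simp_all add: Suc_diff_le)
  \<comment> \<open>The new summand k = n + 1 has coefficient \<open>n choose Suc n\<close>, which
    is 0. Both products can then be indexed alike once the summand k = 0 is split off.\<close>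
  also have "\<dots> = (\<Oplus>k\<in>{..Suc n}. t (n choose k) k (Suc n - k))"
    by (simp add: binomial_eq_0 t0)
  also have "\<dots> = (\<Oplus>k\<in>{..n}. t (n choose Suc k) (Suc k) (n - k)) \<oplus> y [^] Suc n"
    using ty1[of "Suc n"] by (subst finsum_Suc2) simp_all
  finally have y: "?S \<otimes> y = \<dots>" .
  have "(\<Oplus>k\<in>{..Suc n}. t (Suc n choose k) k (Suc n - k)) =
    (\<Oplus>k\<in>{..n}. t (n choose k) (Suc k) (n - k) \<oplus> t (n choose Suc k) (Suc k) (n - k)) \<oplus> y [^] Suc n"
    using ty1[of "Suc n"] by (subst finsum_Suc2) (simp_all add: tadd)
  also have "\<dots> = ?S \<otimes> x \<oplus> ?S \<otimes> y"
    unfolding x y using assms by (subst finsum_addf) (simp_all add: a_assoc)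
  also have "\<dots> = (x \<oplus> y) [^] Suc n"
    using assms Suc.IH by (simp add: r_distr t_def)
  finally show ?case by (simp add: t_def)
qed

end

locale prime_char_cring = cring R for R (structure) +
  fixes p :: nat
  assumes prime_p: "Factorial_Ring.prime p"
    and char_p: "has_characteristic R p"
begin

lemma add_pow_char_multiple:
  assumes "x \<in> carrier R" "p dvd n"
  shows "add_pow R n x = \<zero>"
proof -
  have "add_pow R n \<one> = \<zero>"
    using char_p assms(2) by (simp add: has_characteristic_def)
  then show ?thesis
    using assms(1) add_pow_ldistr[of \<one> x n] by simp
qed

text \<open>For exponent p this is the binomial theorem, since p divides every inner coefficient;
  powers of p follow by iteration.\<close>

lemma pow_char_add:
  assumes "x \<in> carrier R" "y \<in> carrier R"
  shows "(x \<oplus> y) [^] (p ^ n) = x [^] (p ^ n) \<oplus> y [^] (p ^ n)"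
  using assms
proof (induction n arbitrary: x y)
  case (Suc n)
  \<comment> \<open>Writing p as l + 2 lets the successor rules for sums split off the first and the
    last summand, leaving exactly the inner ones.\<close>
  obtain l where l: "p = Suc (Suc l)"
    using prime_ge_2_nat[OF prime_p] by (metis add_2_eq_Suc le_Suc_ex)
  have p: "(x \<oplus> y) [^] p = x [^] p \<oplus> y [^] p" if "x \<in> carrier R" "y \<in> carrier R" for x y
  proof -
    let ?f = "\<lambda>k. add_pow R (p choose k) (x [^] k \<otimes> y [^] (p - k))"
    have f: "?f \<in> A \<rightarrow> carrier R" "?f k \<in> carrier R" for A k
      using that by simp_all
    have "?f (Suc k) = \<zero>" if "k \<in> {..l}" for k
      using that dvd_choose_prime[OF _ _ _ prime_p, of "Suc k"] \<open>x \<in> _\<close> \<open>y \<in> _\<close> l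
      by (intro add_pow_char_multiple) auto
    then have z: "(\<Oplus>k\<in>{..l}. ?f (Suc k)) = \<zero>"
      by (rule add.finprod_one_eqI)
    have "(x \<oplus> y) [^] p = (\<Oplus>k\<in>{..p}. ?f k)"
      using that by (rule binomial_expansion)
    also have "\<dots> = (\<Oplus>k\<in>{..Suc (Suc l)}. ?f k)"
      by (simp only: l)
    also have "\<dots> = ?f (Suc (Suc l)) \<oplus> (\<Oplus>k\<in>{..Suc l}. ?f k)"
      by (rule finsum_Suc[OF f(1)])
    also have "(\<Oplus>k\<in>{..Suc l}. ?f k) = (\<Oplus>k\<in>{..l}. ?f (Suc k)) \<oplus> ?f 0"
      by (rule finsum_Suc2[OF f(1)])
    also have "?f (Suc (Suc l)) \<oplus> \<dots> = x [^] p \<oplus> y [^] p"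
      unfolding z using that by (simp flip: l)
    finally show ?thesis .
  qed
  have "(x \<oplus> y) [^] (p ^ Suc n) = ((x \<oplus> y) [^] (p ^ n)) [^] p"
    using Suc.prems by (simp add: nat_pow_pow mult.commute)
  also have "\<dots> = (x [^] (p ^ n)) [^] p \<oplus> (y [^] (p ^ n)) [^] p"
    using Suc by (simp add: p)
  finally show ?case
    using Suc.prems by (simp add: nat_pow_pow mult.commute)
qed simp

lemma p_pow_pos: "0 < p ^ n"
  using prime_gt_0_nat[OF prime_p] by simp

lemma zero_pow_char: "\<zero> [^] (p ^ n) = \<zero>"
  using p_pow_pos[of n] by (intro nat_pow_zero) auto

text \<open>This is where additivity of the Frobenius enters: it allows Frobenius powers to be
  computed from generators in \<open>frobenius_power_genideal\<close>.\<close>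

lemma ideal_frobenius_preimage:
  assumes "ideal T R"
  shows "ideal {z \<in> carrier R. z [^] (p ^ n) \<in> T} R"
  using ideal_closed[OF assms]
  by (intro ideal_by_closure) (auto simp: pow_char_add nat_pow_distrib zero_pow_char)

lemma frobenius_power_genideal:
  assumes "G \<subseteq> carrier R"
  shows "frobenius_power R (Idl G) (p ^ n) = Idl ((\<lambda>x. x [^] (p ^ n)) ` G)"
proof
  let ?T = "Idl ((\<lambda>x. x [^] (p ^ n)) ` G)"
  have I: "Idl G \<subseteq> carrier R"
    using assms ideal_closed(1) genideal_ideal by blast
  have sub: "(\<lambda>x. x [^] (p ^ n)) ` G \<subseteq> carrier R" using assms by auto
  have T: "ideal ?T R" using sub by (rule genideal_ideal)
  have "Idl G \<subseteq> {z \<in> carrier R. z [^] (p ^ n) \<in> ?T}"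
    using genideal_self[OF sub] assms by (intro genideal_minimal ideal_frobenius_preimage T) auto
  then show "frobenius_power R (Idl G) (p ^ n) \<subseteq> ?T"
    by (auto simp: frobenius_power_subset_iff[OF I T])
  show "?T \<subseteq> frobenius_power R (Idl G) (p ^ n)"
    using genideal_self[OF assms] pow_in_frobenius_power[OF I]
    by (intro genideal_minimal ideal_frobenius_power I) auto
qed

lemma frobenius_power_frobenius_power:
  assumes "A \<subseteq> carrier R"
  shows "frobenius_power R (frobenius_power R A (p ^ m)) (p ^ n) = frobenius_power R A (p ^ (m + n))"
proof -
  have "frobenius_power R (frobenius_power R A (p ^ m)) (p ^ n) =
    Idl ((\<lambda>x. x [^] (p ^ n)) ` (\<lambda>x. x [^] (p ^ m)) ` A)"
    unfolding frobenius_power_def[of R A] using assms by (intro frobenius_power_genideal) auto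
  also have "(\<lambda>x. x [^] (p ^ n)) ` (\<lambda>x. x [^] (p ^ m)) ` A = (\<lambda>x. x [^] (p ^ (m + n))) ` A"
    using assms by (auto simp: nat_pow_pow power_add image_image intro!: image_cong)
  finally show ?thesis by (simp add: frobenius_power_def)
qed

section \<open>Tight closure\<close>

lemma one_off_minimal_primes: "\<one> \<in> off_minimal_primes R"
  unfolding off_minimal_primes_def minimal_prime_def
  using ideal.one_imp_carrier primeideal.axioms(1) primeideal.I_notcarr by fastforce

lemma mult_off_minimal_primes:
  assumes "c \<in> off_minimal_primes R" "d \<in> off_minimal_primes R"
  shows "c \<otimes> d \<in> off_minimal_primes R"
  using assms primeideal.I_prime unfolding off_minimal_primes_def minimal_prime_def
  by fastforce

lemma tight_closureI:
  assumes "x \<in> carrier R" "c \<in> off_minimal_primes R"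
    and "\<And>n. n \<ge> k \<Longrightarrow> c \<otimes> x [^] (p ^ n) \<in> frobenius_power R A (p ^ n)"
  shows "x \<in> tight_closure R p A"
  using assms by (auto simp: tight_closure_def eventually_sequentially)

lemma tight_closureE:
  assumes "x \<in> tight_closure R p A"
  obtains c k where "x \<in> carrier R" "c \<in> off_minimal_primes R" "c \<in> carrier R"
    "\<forall>n\<ge>k. c \<otimes> x [^] (p ^ n) \<in> frobenius_power R A (p ^ n)"
  using assms by (auto simp: tight_closure_def eventually_sequentially off_minimal_primes_def)

lemma subset_tight_closure:
  assumes "A \<subseteq> carrier R"
  shows "A \<subseteq> tight_closure R p A"
proof
  fix x assume "x \<in> A"
  then show "x \<in> tight_closure R p A"
    using assms one_off_minimal_primes pow_in_frobenius_power[OF assms]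
    by (intro tight_closureI[where c = \<one> and k = 0]) auto
qed

lemma ideal_tight_closure:
  assumes "ideal A R"
  shows "ideal (tight_closure R p A) R"
proof (rule ideal_by_closure)
  have A: "A \<subseteq> carrier R" using ideal_closed(1)[OF assms] .
  note F = ideal_closed[OF ideal_frobenius_power[OF A]]
  show "tight_closure R p A \<subseteq> carrier R" by (auto simp: tight_closure_def)
  show "\<zero> \<in> tight_closure R p A" using subset_tight_closure[OF A] ideal_closed(2)[OF assms] by auto
  fix x assume "x \<in> tight_closure R p A"
  then obtain c k where x: "x \<in> carrier R" "c \<in> off_minimal_primes R" "c \<in> carrier R"
    "\<forall>n\<ge>k. c \<otimes> x [^] (p ^ n) \<in> frobenius_power R A (p ^ n)"
    by (rule tight_closureE) blast
  show "r \<otimes> x \<in> tight_closure R p A" if "r \<in> carrier R" for r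
  proof (rule tight_closureI[OF _ x(2)])
    fix n assume "n \<ge> k"
    then have "r [^] (p ^ n) \<otimes> (c \<otimes> x [^] (p ^ n)) \<in> frobenius_power R A (p ^ n)"
      using x(4) that F(4) by auto
    then show "c \<otimes> (r \<otimes> x) [^] (p ^ n) \<in> frobenius_power R A (p ^ n)"
      using that x(1,3) by (simp add: nat_pow_distrib m_lcomm)
  qed (use x(1) that in auto)
  fix y assume "y \<in> tight_closure R p A"
  then obtain d l where y: "y \<in> carrier R" "d \<in> off_minimal_primes R" "d \<in> carrier R"
    "\<forall>n\<ge>l. d \<otimes> y [^] (p ^ n) \<in> frobenius_power R A (p ^ n)"
    by (rule tight_closureE) blast
  \<comment> \<open>The product of the two multipliers serves both elements, from the larger of the
    two bounds on.\<close>
  show "x \<oplus> y \<in> tight_closure R p A"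
  proof (rule tight_closureI[OF _ mult_off_minimal_primes[OF x(2) y(2)]])
    fix n assume n: "n \<ge> max k l"
    have "d \<otimes> (c \<otimes> x [^] (p ^ n)) \<oplus> c \<otimes> (d \<otimes> y [^] (p ^ n)) \<in> frobenius_power R A (p ^ n)"
      using n x(4) y(4) by (intro F(3)[OF F(4)[OF y(3)] F(4)[OF x(3)]]) auto
    also have "d \<otimes> (c \<otimes> x [^] (p ^ n)) \<oplus> c \<otimes> (d \<otimes> y [^] (p ^ n)) =
      (c \<otimes> d) \<otimes> (x \<oplus> y) [^] (p ^ n)"
      using x(1,3) y(1,3) by (simp add: pow_char_add r_distr m_assoc m_lcomm)
    finally show "(c \<otimes> d) \<otimes> (x \<oplus> y) [^] (p ^ n) \<in> frobenius_power R A (p ^ n)" .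
  qed (use x(1) y(1) in auto)
qed

text \<open>A multiplier of x also serves x^(p^m), after shifting the index by m. For m = 1 this
  gives the tight exponents the same recursion as the ordinary ones.\<close>

lemma frobenius_power_tight_closure:
  assumes "ideal A R"
  shows "frobenius_power R (tight_closure R p A) (p ^ m) \<subseteq> tight_closure R p (frobenius_power R A (p ^ m))"
proof (subst frobenius_power_subset_iff)
  have A: "A \<subseteq> carrier R" using ideal_closed(1)[OF assms] .
  show "tight_closure R p A \<subseteq> carrier R" by (auto simp: tight_closure_def)
  show "ideal (tight_closure R p (frobenius_power R A (p ^ m))) R"
    using A by (intro ideal_tight_closure ideal_frobenius_power)
  show "\<forall>x\<in>tight_closure R p A. x [^] (p ^ m) \<in> tight_closure R p (frobenius_power R A (p ^ m))"
  proof
    fix x assume "x \<in> tight_closure R p A"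
    then obtain c k where x: "x \<in> carrier R" "c \<in> off_minimal_primes R" "c \<in> carrier R"
      "\<forall>n\<ge>k. c \<otimes> x [^] (p ^ n) \<in> frobenius_power R A (p ^ n)"
      by (rule tight_closureE) blast
    show "x [^] (p ^ m) \<in> tight_closure R p (frobenius_power R A (p ^ m))"
    proof (rule tight_closureI[OF _ x(2)])
      fix n assume "n \<ge> k"
      then show "c \<otimes> (x [^] (p ^ m)) [^] (p ^ n) \<in>
        frobenius_power R (frobenius_power R A (p ^ m)) (p ^ n)"
        using x(1) x(4)[rule_format, of "m + n"]
        by (simp add: frobenius_power_frobenius_power A nat_pow_pow power_add)
    qed (use x(1) in auto)
  qed
qed

end

section \<open>Prime ideals of noetherian rings\<close>

text \<open>In a noetherian ring a nonempty chain of ideals contains its own union, so Zorn's lemma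
  applies whatever condition defines F.\<close>

lemma (in noetherian_ring) maximal_in_ideal_family:
  assumes "F \<noteq> {}" "\<And>I. I \<in> F \<Longrightarrow> ideal I R"
  shows "\<exists>M\<in>F. \<forall>I\<in>F. M \<subseteq> I \<longrightarrow> I = M"
proof (rule subset_Zorn_nonempty[OF assms(1)])
  fix C assume C: "C \<noteq> {}" "subset.chain F C"
  then have "subset.chain {I. ideal I R} C"
    using assms(2) by (auto simp: pred_on.chain_def)
  then show "\<Union>C \<in> F"
    using ideal_chain_is_trivial[OF C(1)] C(2) by (auto simp: pred_on.chain_def)
qed

lemma (in noetherian_ring) proper_ideal_subset_maximalideal:
  assumes "ideal I R" "I \<noteq> carrier R"
  obtains M where "maximalideal M R" "I \<subseteq> M"
proof -
  let ?F = "{K. ideal K R \<and> I \<subseteq> K \<and> K \<noteq> carrier R}"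
  have "?F \<noteq> {}" using assms by auto
  then have "\<exists>M\<in>?F. \<forall>K\<in>?F. M \<subseteq> K \<longrightarrow> K = M"
    by (rule maximal_in_ideal_family) auto
  then obtain M where M: "M \<in> ?F" "\<forall>K\<in>?F. M \<subseteq> K \<longrightarrow> K = M" ..
  have "maximalideal M R"
  proof (rule maximalidealI)
    fix K assume K: "ideal K R" "M \<subseteq> K" "K \<subseteq> carrier R"
    show "K = M \<or> K = carrier R"
      using K M(1) M(2)[rule_format, of K] by (cases "K = carrier R") auto
  qed (use M(1) in auto)
  then show thesis using M(1) that by blast
qed

locale noetherian_cring = noetherian_ring R + cring R for R (structure)
begin

text \<open>An ideal maximal among those that contain A and no power of f is prime. Read
  contrapositively, this is the gluing principle: A contains a power of f once every prime missing f
  fails to contain A.\<close>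

lemma non_radical_prime:
  assumes "ideal A R" "f \<in> carrier R" "f \<notin> ideal_radical R A"
  obtains P where "primeideal P R" "A \<subseteq> P" "f \<notin> P"
proof -
  let ?F = "{K. ideal K R \<and> A \<subseteq> K \<and> (\<forall>n::nat. f [^] n \<notin> K)}"
  have "?F \<noteq> {}" using assms by (auto simp: ideal_radical_def)
  then have "\<exists>M\<in>?F. \<forall>K\<in>?F. M \<subseteq> K \<longrightarrow> K = M"
    by (rule maximal_in_ideal_family) auto
  then obtain M where M: "M \<in> ?F" "\<forall>K\<in>?F. M \<subseteq> K \<longrightarrow> K = M" ..
  then have iM: "ideal M R" by simp
  note Mc = ideal_closed[OF iM]
  \<comment> \<open>If a is not in M, the ideal M : b contains both M and a. It is thus strictly
    larger than M, and by maximality of M it contains a power of f.\<close>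
  have enlarge: "\<exists>n::nat. f [^] n \<otimes> b \<in> M"
    if "a \<in> carrier R" "b \<in> carrier R" "a \<otimes> b \<in> M" "a \<notin> M" for a b
  proof (rule ccontr)
    let ?K = "colon_ideal R M {b}"
    assume no: "\<not> ?thesis"
    have "ideal ?K R" using iM that by (intro ideal_colon) auto
    moreover have MK: "M \<subseteq> ?K" using Mc(1,5) that(2) by (auto simp: colon_ideal_def)
    moreover have "A \<subseteq> ?K" using M(1) MK by auto
    moreover have "f [^] n \<notin> ?K" for n :: nat
      using no by (auto simp: colon_ideal_def)
    ultimately have "?K = M"
      using M(2) by auto
    moreover have "a \<in> ?K" using that by (auto simp: colon_ideal_def)
    ultimately show False using that(4) by simp
  qed
  have "primeideal M R"
  proof (rule primeidealI[OF iM is_cring])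
    show "carrier R \<noteq> M" using M(1) assms(2) by auto
    fix a b assume ab: "a \<in> carrier R" "b \<in> carrier R" "a \<otimes> b \<in> M"
    show "a \<in> M \<or> b \<in> M"
    proof (rule ccontr)
      assume nin: "\<not> (a \<in> M \<or> b \<in> M)"
      then obtain n :: nat where n: "f [^] n \<otimes> b \<in> M"
        using enlarge[OF ab] by blast
      \<comment> \<open>The second use of \<open>enlarge\<close> has b as the element outside M and
        f^n as the other factor; it produces a power of f in M.\<close>
      then have "b \<otimes> f [^] n \<in> M" using ab(2) assms(2) by (simp add: m_comm)
      then obtain m :: nat where "f [^] m \<otimes> f [^] n \<in> M"
        using enlarge[of b "f [^] n"] nin ab(2) assms(2) by auto
      then have "f [^] (m + n) \<in> M" using assms(2) by (simp add: nat_pow_mult)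
      then show False using M(1) by blast
    qed
  qed
  moreover have "f [^] (1::nat) \<notin> M" using M(1) by blast
  ultimately show thesis
    using that[of M] M(1) assms(2) by simp
qed

end

section \<open>Localization\<close>

text \<open>The operations of \<open>localization\<close> are unions over all representatives.
  Well-definedness makes such a union collapse to a single class.\<close>

lemma UN_pairs_const:
  assumes "(a0, s0) \<in> z" "(b0, t0) \<in> w"
    and "\<And>a s b t. \<lbrakk>(a, s) \<in> z; (b, t) \<in> w\<rbrakk> \<Longrightarrow> F a s b t = K"
  shows "(\<Union>(a, s)\<in>z. \<Union>(b, t)\<in>w. F a s b t) = K"
proof
  show "(\<Union>(a, s)\<in>z. \<Union>(b, t)\<in>w. F a s b t) \<subseteq> K"
    using assms(3) by auto
  show "K \<subseteq> (\<Union>(a, s)\<in>z. \<Union>(b, t)\<in>w. F a s b t)"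
    using assms(1,2) assms(3)[OF assms(1,2)] by blast
qed

locale multiplicative_set = cring R for R (structure) +
  fixes S
  assumes S_carrier: "S \<subseteq> carrier R"
    and S_one: "\<one> \<in> S"
    and S_mult: "\<lbrakk>s \<in> S; t \<in> S\<rbrakk> \<Longrightarrow> s \<otimes> t \<in> S"
begin

abbreviation L where "L \<equiv> localization R S"
abbreviation frac where "frac \<equiv> fraction R S"

lemma S_closed [simp]: "s \<in> S \<Longrightarrow> s \<in> carrier R"
  using S_carrier by auto

declare S_one [simp] S_mult [simp]

lemma equiv_fraction_rel: "equiv (carrier R \<times> S) (fraction_rel R S)"
proof (rule equivI)
  show "fraction_rel R S \<subseteq> (carrier R \<times> S) \<times> (carrier R \<times> S)"
    by (auto simp: fraction_rel_def)
  show "refl_on (carrier R \<times> S) (fraction_rel R S)"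
    by (auto simp: refl_on_def fraction_rel_def intro!: bexI[of _ \<one>])
  show "sym (fraction_rel R S)"
    by (auto simp: sym_def fraction_rel_def intro: sym)
  show "trans (fraction_rel R S)"
  proof (rule transI, clarsimp simp: fraction_rel_def)
    fix a s b t c w u v
    assume c: "a \<in> carrier R" "b \<in> carrier R" "c \<in> carrier R"
      "s \<in> S" "t \<in> S" "w \<in> S" "u \<in> S" "v \<in> S"
      and e1: "u \<otimes> (a \<otimes> t) = u \<otimes> (b \<otimes> s)" and e2: "v \<otimes> (b \<otimes> w) = v \<otimes> (c \<otimes> t)"
    \<comment> \<open>The middle denominator t belongs to the witness: with it both given equations
      can be substituted in turn, without cancelling t.\<close>
    have "(u \<otimes> v \<otimes> t) \<otimes> (a \<otimes> w) = (u \<otimes> (a \<otimes> t)) \<otimes> (v \<otimes> w)"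
      using c by (simp add: m_ac)
    also have "\<dots> = (v \<otimes> (b \<otimes> w)) \<otimes> (u \<otimes> s)"
      unfolding e1 using c by (simp add: m_ac)
    also have "\<dots> = (u \<otimes> v \<otimes> t) \<otimes> (c \<otimes> s)"
      unfolding e2 using c by (simp add: m_ac)
    finally show "\<exists>x\<in>S. x \<otimes> (a \<otimes> w) = x \<otimes> (c \<otimes> s)"
      using c by (intro bexI[of _ "u \<otimes> v \<otimes> t"]) auto
  qed
qed

lemma frac_eq_iff:
  assumes "a \<in> carrier R" "s \<in> S" "b \<in> carrier R" "t \<in> S"
  shows "frac a s = frac b t \<longleftrightarrow> (\<exists>u\<in>S. u \<otimes> (a \<otimes> t) = u \<otimes> (b \<otimes> s))"
  unfolding fraction_def using assms
  by (subst eq_equiv_class_iff[OF equiv_fraction_rel]) (auto simp: fraction_rel_def)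

lemma frac_eqI:
  assumes "a \<in> carrier R" "s \<in> S" "b \<in> carrier R" "t \<in> S" "a \<otimes> t = b \<otimes> s"
  shows "frac a s = frac b t"
  using assms by (auto simp: frac_eq_iff intro!: bexI[of _ \<one>])

lemma frac_self: "\<lbrakk>a \<in> carrier R; s \<in> S\<rbrakk> \<Longrightarrow> (a, s) \<in> frac a s"
  unfolding fraction_def using equiv_class_self[OF equiv_fraction_rel] by auto

lemma frac_memD:
  assumes "(b, t) \<in> frac a s"
  shows "a \<in> carrier R" "s \<in> S" "b \<in> carrier R" "t \<in> S"
    "\<exists>u\<in>S. u \<otimes> (a \<otimes> t) = u \<otimes> (b \<otimes> s)"
  using assms by (auto simp: fraction_def fraction_rel_def)

lemma carrier_L: "carrier L = {frac a s | a s. a \<in> carrier R \<and> s \<in> S}"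
  by (auto simp: localization_def fraction_def quotient_def)

lemma frac_closed [simp]: "\<lbrakk>a \<in> carrier R; s \<in> S\<rbrakk> \<Longrightarrow> frac a s \<in> carrier L"
  by (auto simp: carrier_L)

lemma L_cases:
  assumes "x \<in> carrier L"
  obtains a s where "a \<in> carrier R" "s \<in> S" "x = frac a s"
  using assms by (auto simp: carrier_L)

lemma one_L: "\<one>\<^bsub>L\<^esub> = frac \<one> \<one>" and zero_L: "\<zero>\<^bsub>L\<^esub> = frac \<zero> \<one>"
  by (simp_all add: localization_def)

lemma frac_mult:
  assumes "a \<in> carrier R" "s \<in> S" "b \<in> carrier R" "t \<in> S"
  shows "frac a s \<otimes>\<^bsub>L\<^esub> frac b t = frac (a \<otimes> b) (s \<otimes> t)"
  unfolding localization_def monoid.simps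
proof (rule UN_pairs_const[OF frac_self frac_self])
  fix a' s' b' t' assume 1: "(a', s') \<in> frac a s" and 2: "(b', t') \<in> frac b t"
  obtain u where u: "u \<in> S" "u \<otimes> (a \<otimes> s') = u \<otimes> (a' \<otimes> s)" using frac_memD(5)[OF 1] by auto
  obtain v where v: "v \<in> S" "v \<otimes> (b \<otimes> t') = v \<otimes> (b' \<otimes> t)" using frac_memD(5)[OF 2] by auto
  note c = assms frac_memD[OF 1] frac_memD[OF 2] u(1) v(1)
  have "(u \<otimes> v) \<otimes> ((a' \<otimes> b') \<otimes> (s \<otimes> t)) = (u \<otimes> (a' \<otimes> s)) \<otimes> (v \<otimes> (b' \<otimes> t))"
    using c by (simp add: m_ac)
  also have "\<dots> = (u \<otimes> v) \<otimes> ((a \<otimes> b) \<otimes> (s' \<otimes> t'))"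
    unfolding u(2)[symmetric] v(2)[symmetric] using c by (simp add: m_ac)
  finally show "frac (a' \<otimes> b') (s' \<otimes> t') = frac (a \<otimes> b) (s \<otimes> t)"
    using c by (subst frac_eq_iff) (auto intro!: bexI[of _ "u \<otimes> v"])
qed (use assms in auto)

lemma frac_add:
  assumes "a \<in> carrier R" "s \<in> S" "b \<in> carrier R" "t \<in> S"
  shows "frac a s \<oplus>\<^bsub>L\<^esub> frac b t = frac (a \<otimes> t \<oplus> b \<otimes> s) (s \<otimes> t)"
  unfolding localization_def ring.simps
proof (rule UN_pairs_const[OF frac_self frac_self])
  fix a' s' b' t' assume 1: "(a', s') \<in> frac a s" and 2: "(b', t') \<in> frac b t"
  obtain u where u: "u \<in> S" "u \<otimes> (a \<otimes> s') = u \<otimes> (a' \<otimes> s)" using frac_memD(5)[OF 1] by auto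
  obtain v where v: "v \<in> S" "v \<otimes> (b \<otimes> t') = v \<otimes> (b' \<otimes> t)" using frac_memD(5)[OF 2] by auto
  note c = assms frac_memD[OF 1] frac_memD[OF 2] u(1) v(1)
  have "(u \<otimes> v) \<otimes> ((a' \<otimes> t' \<oplus> b' \<otimes> s') \<otimes> (s \<otimes> t)) =
    (u \<otimes> (a' \<otimes> s)) \<otimes> (v \<otimes> t \<otimes> t') \<oplus> (v \<otimes> (b' \<otimes> t)) \<otimes> (u \<otimes> s \<otimes> s')"
    using c by (simp add: m_ac l_distr r_distr)
  also have "\<dots> = (u \<otimes> v) \<otimes> ((a \<otimes> t \<oplus> b \<otimes> s) \<otimes> (s' \<otimes> t'))"
    unfolding u(2)[symmetric] v(2)[symmetric] using c by (simp add: m_ac l_distr r_distr)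
  finally show "frac (a' \<otimes> t' \<oplus> b' \<otimes> s') (s' \<otimes> t') = frac (a \<otimes> t \<oplus> b \<otimes> s) (s \<otimes> t)"
    using c by (subst frac_eq_iff) (auto intro!: bexI[of _ "u \<otimes> v"])
qed (use assms in auto)

lemma frac_add_same:
  assumes "a \<in> carrier R" "b \<in> carrier R" "s \<in> S"
  shows "frac a s \<oplus>\<^bsub>L\<^esub> frac b s = frac (a \<oplus> b) s"
  unfolding frac_add[OF assms(1,3,2,3)]
  by (rule frac_eqI) (use assms in \<open>simp_all add: l_distr m_assoc\<close>)

lemma frac_pow:
  assumes "a \<in> carrier R"
  shows "frac a \<one> [^]\<^bsub>L\<^esub> (n::nat) = frac (a [^] n) \<one>"
  using assms by (induction n) (simp_all add: one_L frac_mult)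

text \<open>Minimal primes of the localization contract to minimal primes.\<close>

lemma frac_off_minimal_primes:
  assumes "d \<in> off_minimal_primes R"
  shows "frac d \<one> \<in> off_minimal_primes L"
proof -
  have d: "d \<in> carrier R" using assms by (simp add: off_minimal_primes_def)
  have "frac d \<one> \<notin> Q" if "minimal_prime L Q" for Q
  proof
    assume dQ: "frac d \<one> \<in> Q"
    from that have Q: "primeideal Q L" and Qmin: "\<And>K. \<lbrakk>primeideal K L; K \<subseteq> Q\<rbrakk> \<Longrightarrow> K = Q"
      by (auto simp: minimal_prime_def)
    interpret Q: primeideal Q L by (rule Q)
    note Qc = Q.ideal_closed[OF Q.is_ideal]
    define C where "C = {a \<in> carrier R. frac a \<one> \<in> Q}"
    have C_S: "s \<notin> C" if "s \<in> S" for s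
    proof
      assume "s \<in> C"
      then have "frac \<one> s \<otimes>\<^bsub>L\<^esub> frac s \<one> \<in> Q"
        using that by (intro Qc(4)) (auto simp: C_def)
      also have "frac \<one> s \<otimes>\<^bsub>L\<^esub> frac s \<one> = \<one>\<^bsub>L\<^esub>"
        unfolding frac_mult[OF one_closed that S_closed[OF that] S_one] one_L
        by (rule frac_eqI) (use that in simp_all)
      finally show False using Q.one_imp_carrier Q.I_notcarr by simp
    qed
    have "primeideal C R"
    proof (rule primeidealI[OF ideal_by_closure is_cring])
      show "C \<subseteq> carrier R" by (auto simp: C_def)
      show "\<zero> \<in> C" using Qc(2) by (simp add: C_def zero_L)
      show "x \<oplus> y \<in> C" if "x \<in> C" "y \<in> C" for x y
        using that Qc(3)[of "frac x \<one>" "frac y \<one>"] by (simp add: C_def frac_add_same)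
      show "r \<otimes> x \<in> C" if "r \<in> carrier R" "x \<in> C" for r x
        using that Qc(4)[of "frac r \<one>" "frac x \<one>"] by (simp add: C_def frac_mult)
      show "carrier R \<noteq> C" using C_S[OF S_one] by auto
      show "a \<in> C \<or> b \<in> C" if "a \<in> carrier R" "b \<in> carrier R" "a \<otimes> b \<in> C" for a b
        using that Q.I_prime[of "frac a \<one>" "frac b \<one>"] by (simp add: C_def frac_mult)
    qed
    moreover have "K = C" if K: "primeideal K R" "K \<subseteq> C" for K
    proof
      interpret K: primeideal K R by (rule K(1))
      note Kc = ideal_closed[OF K.is_ideal]
      \<comment> \<open>E is the extension of K to the localization. It is a prime inside Q, so it
        equals Q by minimality, and contracting it back shows that C lies in K.\<close>
      define E where "E = {frac a s | a s. a \<in> K \<and> s \<in> S}"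
      have EI: "frac a s \<in> E" if "a \<in> K" "s \<in> S" for a s
        using that by (auto simp: E_def)
      \<comment> \<open>Membership is independent of the representative: u a t lies in K, while u
        and t do not, because K lies in C and C contains no denominator.\<close>
      have ED: "a \<in> K" if as: "frac a s \<in> E" "a \<in> carrier R" "s \<in> S" for a s
      proof -
        obtain b t where b: "frac a s = frac b t" "b \<in> K" "t \<in> S"
          using as(1) by (auto simp: E_def)
        then obtain u where u: "u \<in> S" "u \<otimes> (a \<otimes> t) = u \<otimes> (b \<otimes> s)"
          using frac_eq_iff[of a s b t] as(2,3) Kc(1) by auto
        have "u \<otimes> (b \<otimes> s) \<in> K" using u b as(3) Kc(4,5) by auto
        then have "u \<in> K \<or> a \<in> K \<or> t \<in> K"
          using K.I_prime[of u "a \<otimes> t"] K.I_prime[of a t] u b(3) as(2) by auto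
        then show "a \<in> K" using C_S u(1) b(3) K(2) by auto
      qed
      have "E \<subseteq> Q"
      proof (clarsimp simp: E_def)
        fix a s assume a: "a \<in> K" "s \<in> S"
        then have "frac \<one> s \<otimes>\<^bsub>L\<^esub> frac a \<one> \<in> Q"
          using K(2) by (intro Qc(4)) (auto simp: C_def)
        then show "frac a s \<in> Q" using a Kc(1) by (auto simp: frac_mult)
      qed
      moreover have "primeideal E L"
      proof (rule primeidealI[OF Q.ideal_by_closure Q.is_cring])
        show "E \<subseteq> carrier L" using Kc(1) by (auto simp: E_def)
        show "\<zero>\<^bsub>L\<^esub> \<in> E" using Kc(2) by (auto simp: zero_L intro: EI)
        show "x \<oplus>\<^bsub>L\<^esub> y \<in> E" if xy: "x \<in> E" "y \<in> E" for x y
        proof -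
          obtain a s b t where e: "x = frac a s" "a \<in> K" "s \<in> S" "y = frac b t" "b \<in> K" "t \<in> S"
            using xy by (auto simp: E_def)
          then have "a \<in> carrier R" "b \<in> carrier R" using Kc(1) by auto
          then show ?thesis using e Kc(3,5) by (auto simp: frac_add intro!: EI)
        qed
        show "r \<otimes>\<^bsub>L\<^esub> x \<in> E" if rx: "r \<in> carrier L" "x \<in> E" for r x
        proof -
          obtain b t where e: "x = frac b t" "b \<in> K" "t \<in> S"
            using rx by (auto simp: E_def)
          moreover obtain a s where "r = frac a s" "a \<in> carrier R" "s \<in> S"
            using rx L_cases by metis
          moreover have "b \<in> carrier R" using e Kc(1) by auto
          ultimately show ?thesis using Kc(4) by (auto simp: frac_mult intro!: EI)
        qed
        show "carrier L \<noteq> E"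
          using \<open>E \<subseteq> Q\<close> Q.I_notcarr Qc(1) by blast
        show "x \<in> E \<or> y \<in> E" if xy: "x \<in> carrier L" "y \<in> carrier L" "x \<otimes>\<^bsub>L\<^esub> y \<in> E" for x y
        proof -
          obtain a s where a: "x = frac a s" "a \<in> carrier R" "s \<in> S" using xy L_cases by metis
          obtain b t where b: "y = frac b t" "b \<in> carrier R" "t \<in> S" using xy L_cases by metis
          have "a \<otimes> b \<in> K" using xy(3) a b by (intro ED[of "a \<otimes> b" "s \<otimes> t"]) (auto simp: frac_mult)
          then show ?thesis using K.I_prime a b by (auto intro: EI)
        qed
      qed
      ultimately have "E = Q" by (intro Qmin)
      then show "C \<subseteq> K" using ED by (auto simp: C_def)
    qed (rule K(2))
    ultimately have "minimal_prime R C" by (auto simp: minimal_prime_def)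
    then show False using assms dQ d by (auto simp: off_minimal_primes_def C_def)
  qed
  then show ?thesis using d by (auto simp: off_minimal_primes_def)
qed

lemma common_denominator:
  assumes "finite B" "g \<in> B \<rightarrow> carrier L"
  shows "\<exists>t\<in>S. \<forall>b\<in>B. \<exists>y\<in>carrier R. g b = frac y t"
  using assms
proof (induction B rule: finite_induct)
  case (insert b B)
  then obtain t where t: "t \<in> S" "\<And>b. b \<in> B \<Longrightarrow> \<exists>y\<in>carrier R. g b = frac y t" by auto
  obtain a s where a: "g b = frac a s" "a \<in> carrier R" "s \<in> S"
    using insert.prems L_cases by (metis Pi_iff insertI1)
  have "\<exists>y\<in>carrier R. g c = frac y (t \<otimes> s)" if c: "c \<in> insert b B" for c
  proof (cases "c = b")
    case True
    have "frac a s = frac (a \<otimes> t) (t \<otimes> s)"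
      by (rule frac_eqI) (use a t(1) in \<open>simp_all add: m_ac\<close>)
    then show ?thesis using True a t(1) by auto
  next
    case False
    then obtain y where y: "y \<in> carrier R" "g c = frac y t" using t(2)[of c] c by auto
    have "frac y t = frac (y \<otimes> s) (t \<otimes> s)"
      by (rule frac_eqI) (use y(1) a(3) t(1) in \<open>simp_all add: m_ac\<close>)
    then show ?thesis using y a(3) by auto
  qed
  then show ?case using t(1) a(3) by (intro bexI[of _ "t \<otimes> s"]) auto
qed (intro bexI[OF _ S_one], simp)

lemma common_annihilator:
  assumes "finite A" "\<And>a. a \<in> A \<Longrightarrow> a \<in> carrier R \<and> (\<exists>v\<in>S. v \<otimes> a = \<zero>)"
  shows "\<exists>u\<in>S. \<forall>a\<in>A. u \<otimes> a = \<zero>"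
  using assms
proof (induction A rule: finite_induct)
  case (insert b A)
  then obtain u where u: "u \<in> S" "\<And>a. a \<in> A \<Longrightarrow> u \<otimes> a = \<zero>" by auto
  obtain v where v: "v \<in> S" "v \<otimes> b = \<zero>" using insert.prems by auto
  have "(u \<otimes> v) \<otimes> a = \<zero>" if a: "a \<in> insert b A" for a
  proof (cases "a = b")
    case True
    then show ?thesis using u(1) v insert.prems[OF a] by (simp add: m_assoc)
  next
    case False
    then have "(u \<otimes> v) \<otimes> a = v \<otimes> (u \<otimes> a)"
      using u(1) v(1) insert.prems[OF a] by (simp add: m_ac)
    also have "\<dots> = \<zero>" using False a u(2)[of a] v(1) by simp
    finally show ?thesis .
  qed
  then show ?case using u(1) v(1) by (intro bexI[of _ "u \<otimes> v"]) auto
qed (intro bexI[OF _ S_one], simp)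

end

text \<open>The kernel of the map to a localization is finitely generated, so one denominator kills it.\<close>

lemma kernel_annihilator:
  assumes "noetherian_ring R" "multiplicative_set R S"
  obtains u where "u \<in> S"
    "\<And>v y. \<lbrakk>v \<in> S; y \<in> carrier R; v \<otimes>\<^bsub>R\<^esub> y = \<zero>\<^bsub>R\<^esub>\<rbrakk> \<Longrightarrow> u \<otimes>\<^bsub>R\<^esub> y = \<zero>\<^bsub>R\<^esub>"
proof -
  interpret noetherian_ring R by (rule assms)
  interpret multiplicative_set R S by (rule assms)
  define K where "K = {y \<in> carrier R. \<exists>v\<in>S. v \<otimes>\<^bsub>R\<^esub> y = \<zero>\<^bsub>R\<^esub>}"
  have "ideal K R"
  proof (rule ideal_by_closure)
    show "\<zero>\<^bsub>R\<^esub> \<in> K" unfolding K_def by (intro CollectI conjI bexI[OF _ S_one]) simp_all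
    show "x \<oplus>\<^bsub>R\<^esub> y \<in> K" if xy: "x \<in> K" "y \<in> K" for x y
    proof -
      obtain v w where v: "v \<in> S" "v \<otimes>\<^bsub>R\<^esub> x = \<zero>\<^bsub>R\<^esub>" "w \<in> S" "w \<otimes>\<^bsub>R\<^esub> y = \<zero>\<^bsub>R\<^esub>"
        "x \<in> carrier R" "y \<in> carrier R"
        using xy by (auto simp: K_def)
      have "(v \<otimes>\<^bsub>R\<^esub> w) \<otimes>\<^bsub>R\<^esub> (x \<oplus>\<^bsub>R\<^esub> y) = w \<otimes>\<^bsub>R\<^esub> (v \<otimes>\<^bsub>R\<^esub> x) \<oplus>\<^bsub>R\<^esub> v \<otimes>\<^bsub>R\<^esub> (w \<otimes>\<^bsub>R\<^esub> y)"
        using v(1,3,5,6) by (simp add: r_distr m_ac)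
      then show ?thesis using v by (auto simp: K_def intro!: bexI[of _ "v \<otimes>\<^bsub>R\<^esub> w"])
    qed
    show "r \<otimes>\<^bsub>R\<^esub> x \<in> K" if rx: "r \<in> carrier R" "x \<in> K" for r x
    proof -
      obtain v where v: "v \<in> S" "v \<otimes>\<^bsub>R\<^esub> x = \<zero>\<^bsub>R\<^esub>" "x \<in> carrier R"
        using rx by (auto simp: K_def)
      then have "v \<otimes>\<^bsub>R\<^esub> (r \<otimes>\<^bsub>R\<^esub> x) = \<zero>\<^bsub>R\<^esub>" using rx(1) by (simp add: m_lcomm)
      then show ?thesis using v rx by (auto simp: K_def)
    qed
  qed (auto simp: K_def)
  then obtain A where A: "A \<subseteq> carrier R" "finite A" "K = Idl\<^bsub>R\<^esub> A"
    using finetely_gen by blast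
  then have AK: "A \<subseteq> K" using genideal_self by blast
  obtain u where u: "u \<in> S" "\<forall>a\<in>A. u \<otimes>\<^bsub>R\<^esub> a = \<zero>\<^bsub>R\<^esub>"
    using common_annihilator[OF A(2)] AK by (auto simp: K_def)
  have "K \<subseteq> colon_ideal R {\<zero>\<^bsub>R\<^esub>} {u}"
    unfolding A(3) using u A(1) zeroideal
    by (intro genideal_minimal ideal_colon) (auto simp: colon_ideal_def m_comm subset_iff)
  then have "u \<otimes>\<^bsub>R\<^esub> y = \<zero>\<^bsub>R\<^esub>" if "v \<in> S" "y \<in> carrier R" "v \<otimes>\<^bsub>R\<^esub> y = \<zero>\<^bsub>R\<^esub>" for v y
    using that u(1) m_comm[of u y] by (auto simp: K_def colon_ideal_def)
  then show thesis using u(1) that by blast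
qed

section \<open>Cartier linear maps\<close>

text \<open>An \<open>R\<close>-linear map \<open>F\<^sup>e\<^sub>*R \<rightarrow> R\<close>.\<close>

definition cartier_linear :: "('a, 'b) ring_scheme \<Rightarrow> nat \<Rightarrow> nat \<Rightarrow> ('a \<Rightarrow> 'a) \<Rightarrow> bool" where
  "cartier_linear R p e \<phi> \<longleftrightarrow> \<phi> \<in> carrier R \<rightarrow> carrier R \<and>
     (\<forall>x\<in>carrier R. \<forall>y\<in>carrier R. \<phi> (x \<oplus>\<^bsub>R\<^esub> y) = \<phi> x \<oplus>\<^bsub>R\<^esub> \<phi> y) \<and>
     (\<forall>r\<in>carrier R. \<forall>x\<in>carrier R. \<phi> (r [^]\<^bsub>R\<^esub> (p ^ e) \<otimes>\<^bsub>R\<^esub> x) = r \<otimes>\<^bsub>R\<^esub> \<phi> x)"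

lemma strongly_F_regular_alt:
  "strongly_F_regular R p \<longleftrightarrow>
    (\<forall>c\<in>off_minimal_primes R. \<exists>e>0. \<exists>\<phi>. cartier_linear R p e \<phi> \<and> \<phi> c = \<one>\<^bsub>R\<^esub>)"
  unfolding strongly_F_regular_def cartier_linear_def by blast

lemma cartier_linearD:
  assumes "cartier_linear R p e \<phi>"
  shows "x \<in> carrier R \<Longrightarrow> \<phi> x \<in> carrier R"
    and "\<lbrakk>x \<in> carrier R; y \<in> carrier R\<rbrakk> \<Longrightarrow> \<phi> (x \<oplus>\<^bsub>R\<^esub> y) = \<phi> x \<oplus>\<^bsub>R\<^esub> \<phi> y"
    and "\<lbrakk>r \<in> carrier R; x \<in> carrier R\<rbrakk> \<Longrightarrow> \<phi> (r [^]\<^bsub>R\<^esub> (p ^ e) \<otimes>\<^bsub>R\<^esub> x) = r \<otimes>\<^bsub>R\<^esub> \<phi> x"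
  using assms by (auto simp: cartier_linear_def)

context prime_char_cring
begin

lemma cartier_linear_zero:
  assumes "cartier_linear R p e \<phi>"
  shows "\<phi> \<zero> = \<zero>"
  using cartier_linearD(3)[OF assms, of \<zero> \<zero>] cartier_linearD(1)[OF assms, of \<zero>]
  by (simp add: zero_pow_char)

text \<open>The levels add because F^d_* F^e_*R = F^(d+e)_*R. The twist by a gives control over the
  value at \<open>\<one>\<close> when a map is iterated.\<close>

lemma cartier_linear_comp:
  assumes "cartier_linear R p d \<theta>" "cartier_linear R p e \<phi>" "a \<in> carrier R"
  shows "cartier_linear R p (d + e) (\<lambda>z. \<theta> (a \<otimes> \<phi> z))"
  unfolding cartier_linear_def
proof (intro conjI ballI)
  note T = cartier_linearD[OF assms(1)] and F = cartier_linearD[OF assms(2)]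
  show "(\<lambda>z. \<theta> (a \<otimes> \<phi> z)) \<in> carrier R \<rightarrow> carrier R"
    using T(1) F(1) assms(3) by auto
  fix x y assume x: "x \<in> carrier R" "y \<in> carrier R"
  show "\<theta> (a \<otimes> \<phi> (x \<oplus> y)) = \<theta> (a \<otimes> \<phi> x) \<oplus> \<theta> (a \<otimes> \<phi> y)"
    using x assms(3) by (simp add: F r_distr T)
  have "\<phi> (x [^] (p ^ (d + e)) \<otimes> y) = x [^] (p ^ d) \<otimes> \<phi> y"
    using F(3)[of "x [^] (p ^ d)" y] x by (simp add: nat_pow_pow power_add)
  then show "\<theta> (a \<otimes> \<phi> (x [^] (p ^ (d + e)) \<otimes> y)) = x \<otimes> \<theta> (a \<otimes> \<phi> y)"
    using T(3)[of x "a \<otimes> \<phi> y"] x assms(3) F(1) by (simp add: m_lcomm)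
qed

text \<open>The map extracts p^e-th roots: on a multiple r a^(p^(e+n)) of a generator its value is
  a^(p^n) times its value at r.\<close>

lemma cartier_linear_frobenius_power:
  assumes "cartier_linear R p e \<phi>" "A \<subseteq> carrier R" "z \<in> frobenius_power R A (p ^ (e + n))"
  shows "\<phi> z \<in> frobenius_power R A (p ^ n)"
proof -
  note F = cartier_linearD[OF assms(1)]
  let ?T = "frobenius_power R A (p ^ n)"
  have "ideal ?T R" using assms(2) by (rule ideal_frobenius_power)
  note T = ideal_closed[OF this]
  \<comment> \<open>Since \<phi> is only semilinear, the condition is imposed on all multiples of z;
    this makes D an ideal.\<close>
  define D where "D = {z \<in> carrier R. \<forall>r\<in>carrier R. \<phi> (r \<otimes> z) \<in> ?T}"
  have "ideal D R"
  proof (rule ideal_by_closure)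
    show "\<zero> \<in> D" using T(2) by (simp add: D_def cartier_linear_zero[OF assms(1)])
    show "x \<oplus> y \<in> D" if "x \<in> D" "y \<in> D" for x y
      using that T(3) by (auto simp: D_def r_distr F)
    show "r \<otimes> x \<in> D" if "r \<in> carrier R" "x \<in> D" for r x
      using that by (auto simp: D_def simp flip: m_assoc)
  qed (auto simp: D_def)
  moreover have "a [^] (p ^ (e + n)) \<in> D" if "a \<in> A" for a
  proof -
    have a: "a \<in> carrier R" using that assms(2) by auto
    have "\<phi> (r \<otimes> a [^] (p ^ (e + n))) = a [^] (p ^ n) \<otimes> \<phi> r" if "r \<in> carrier R" for r
      using F(3)[of "a [^] (p ^ n)" r] a that
      by (simp add: nat_pow_pow m_comm power_add mult.commute)
    then show ?thesis
      using a T(5) F(1) pow_in_frobenius_power[OF assms(2) that] by (auto simp: D_def)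
  qed
  ultimately have "frobenius_power R A (p ^ (e + n)) \<subseteq> D"
    using assms(2) by (simp add: frobenius_power_subset_iff)
  then have "z \<in> carrier R" "\<phi> (\<one> \<otimes> z) \<in> ?T" using assms(3) by (auto simp: D_def)
  then show ?thesis by simp
qed

text \<open>Finite generation of \<open>F\<^sup>e\<^sub>*R\<close>, phrased through its submodules.\<close>

lemma F_finite_span:
  assumes "F_finite R p"
  shows "\<exists>B. finite B \<and> B \<subseteq> carrier R \<and>
    (\<forall>D. B \<subseteq> D \<longrightarrow> \<zero> \<in> D \<longrightarrow> (\<forall>x\<in>D. \<forall>y\<in>D. x \<oplus> y \<in> D) \<longrightarrow>
      (\<forall>r\<in>carrier R. \<forall>x\<in>D. r [^] (p ^ e) \<otimes> x \<in> D) \<longrightarrow> carrier R \<subseteq> D)"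
proof (induction e)
  case 0
  have "carrier R \<subseteq> D"
    if "{\<one>} \<subseteq> D" "\<forall>r\<in>carrier R. \<forall>x\<in>D. r [^] (p ^ 0) \<otimes> x \<in> D" for D
  proof
    fix r assume r: "r \<in> carrier R"
    then have "r [^] (p ^ 0) \<otimes> \<one> \<in> D" using that by blast
    then show "r \<in> D" using r by simp
  qed
  then show ?case by (intro exI[of _ "{\<one>}"]) auto
next
  case (Suc e)
  obtain B where B: "finite B" "B \<subseteq> carrier R"
    "\<forall>x\<in>carrier R. \<exists>r\<in>B \<rightarrow> carrier R. x = (\<Oplus>b\<in>B. r b [^] p \<otimes> b)"
    using assms unfolding F_finite_def by auto
  obtain C where C: "finite C" "C \<subseteq> carrier R"
    "\<And>D. \<lbrakk>C \<subseteq> D; \<zero> \<in> D; \<forall>x\<in>D. \<forall>y\<in>D. x \<oplus> y \<in> D;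
      \<forall>r\<in>carrier R. \<forall>x\<in>D. r [^] (p ^ e) \<otimes> x \<in> D\<rbrakk> \<Longrightarrow> carrier R \<subseteq> D"
    using Suc.IH by auto
  \<comment> \<open>Expand x with coefficients \<open>r b [^] p\<close>, then expand
    \<open>r b\<close> over C at level e. Raising the latter to the p-th power gives the generators
    c^p b, with p^(e+1)-th powers as coefficients.\<close>
  let ?G = "(\<lambda>(c, b). c [^] p \<otimes> b) ` (C \<times> B)"
  have "carrier R \<subseteq> D"
    if D: "?G \<subseteq> D" "\<zero> \<in> D" "\<forall>x\<in>D. \<forall>y\<in>D. x \<oplus> y \<in> D"
      "\<forall>r\<in>carrier R. \<forall>x\<in>D. r [^] (p ^ Suc e) \<otimes> x \<in> D" for D
  proof
    fix x assume "x \<in> carrier R"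
    then obtain r where r: "r \<in> B \<rightarrow> carrier R" "x = (\<Oplus>b\<in>B. r b [^] p \<otimes> b)"
      using B(3) by auto
    \<comment> \<open>For fixed b the elements z with z^p b in D form a submodule of F^e_*R
      containing C, so they exhaust the ring.\<close>
    have zb: "z [^] p \<otimes> b \<in> D" if b: "b \<in> B" and z: "z \<in> carrier R" for z b
    proof -
      let ?D = "{z \<in> carrier R. z [^] p \<otimes> b \<in> D}"
      have bc: "b \<in> carrier R" using b B(2) by auto
      have "carrier R \<subseteq> ?D"
      proof (rule C(3))
        show "C \<subseteq> ?D" using C(2) D(1) b by auto
        show "\<zero> \<in> ?D" using zero_pow_char[of 1] D(2) bc by simp
        show "\<forall>x\<in>?D. \<forall>y\<in>?D. x \<oplus> y \<in> ?D"
          using pow_char_add[of _ _ 1] D(3) bc by (auto simp: l_distr)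
        show "\<forall>r\<in>carrier R. \<forall>x\<in>?D. r [^] (p ^ e) \<otimes> x \<in> ?D"
          using D(4) bc by (auto simp: nat_pow_distrib nat_pow_pow m_assoc mult.commute)
      qed
      then show ?thesis using z by auto
    qed
    have "(\<Oplus>b\<in>E. r b [^] p \<otimes> b) \<in> D" if "finite E" "E \<subseteq> B" for E
      using that
    proof (induction E rule: finite_induct)
      case (insert b E)
      then have bE: "b \<in> B" "E \<subseteq> B" by auto
      then have "r b [^] p \<otimes> b \<in> carrier R" "(\<lambda>b. r b [^] p \<otimes> b) \<in> E \<rightarrow> carrier R"
        using r(1) B(2) by (auto simp: subset_iff Pi_iff)
      then have "(\<Oplus>b\<in>insert b E. r b [^] p \<otimes> b) = r b [^] p \<otimes> b \<oplus> (\<Oplus>b\<in>E. r b [^] p \<otimes> b)"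
        using insert.hyps by (intro finsum_insert)
      then show ?case
        using insert.IH[OF bE(2)] zb[OF bE(1)] r(1) bE(1) D(3) by auto
    qed (use D(2) in simp)
    then show "x \<in> D" using r(2) B(1) by blast
  qed
  moreover have "?G \<subseteq> carrier R" "finite ?G" using B(1,2) C(1,2) by (auto simp: subset_iff)
  ultimately show ?case by (intro exI[of _ ?G]) blast
qed

end

section \<open>Lifting local splittings to maps on the ring\<close>

locale noetherian_prime_char = noetherian_cring R + prime_char_cring R p
  for R (structure) and p :: nat

locale F_finite_noetherian = noetherian_prime_char +
  assumes F_fin: "F_finite R p"
begin

lemma strongly_F_regular_localization:
  assumes "primeideal P R" "strongly_F_regular (localization_at R P) p"
    and "d \<in> off_minimal_primes R"
  obtains e \<phi> where "e > 0" "cartier_linear R p e \<phi>" "\<phi> d \<notin> P"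
proof -
  interpret P: primeideal P R by (rule assms(1))
  note Pc = ideal_closed[OF P.is_ideal]
  define S where "S = carrier R - P"
  interpret multiplicative_set R S
  proof
    show "\<one> \<in> S" using P.one_imp_carrier P.I_notcarr by (auto simp: S_def)
  qed (use P.I_prime in \<open>auto simp: S_def\<close>)
  have d: "d \<in> carrier R" using assms(3) by (simp add: off_minimal_primes_def)
  have "frac d \<one> \<in> off_minimal_primes L" using assms(3) by (rule frac_off_minimal_primes)
  then obtain e \<psi> where e: "e > 0" and \<psi>: "cartier_linear L p e \<psi>" and \<psi>d: "\<psi> (frac d \<one>) = \<one>\<^bsub>L\<^esub>"
    using assms(2) unfolding strongly_F_regular_alt S_def by blast
  define g where "g x = \<psi> (frac x \<one>)" for x
  have g_closed: "g x \<in> carrier L" if "x \<in> carrier R" for x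
    using cartier_linearD(1)[OF \<psi>] that by (simp add: g_def)
  have g_add: "g (x \<oplus> y) = g x \<oplus>\<^bsub>L\<^esub> g y" if "x \<in> carrier R" "y \<in> carrier R" for x y
    using cartier_linearD(2)[OF \<psi>, of "frac x \<one>" "frac y \<one>"] that by (simp add: g_def frac_add_same)
  have g_mult: "g (r [^] (p ^ e) \<otimes> x) = frac r \<one> \<otimes>\<^bsub>L\<^esub> g x"
    if "r \<in> carrier R" "x \<in> carrier R" for r x
    using cartier_linearD(3)[OF \<psi>, of "frac r \<one>" "frac x \<one>"] that
    by (simp add: g_def frac_pow frac_mult)
  obtain B where B: "finite B" "B \<subseteq> carrier R"
    and span: "\<And>D. \<lbrakk>B \<subseteq> D; \<zero> \<in> D; \<forall>x\<in>D. \<forall>y\<in>D. x \<oplus> y \<in> D;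
      \<forall>r\<in>carrier R. \<forall>x\<in>D. r [^] (p ^ e) \<otimes> x \<in> D\<rbrakk> \<Longrightarrow> carrier R \<subseteq> D"
    using F_finite_span[OF F_fin, of e] by auto
  \<comment> \<open>One denominator for the values on the finitely many module generators is a
    denominator for every value of g.\<close>
  obtain t where t: "t \<in> S" "\<forall>b\<in>B. \<exists>y\<in>carrier R. g b = frac y t"
    using common_denominator[OF B(1), of g] B(2) g_closed by auto
  have smul: "frac r \<one> \<otimes>\<^bsub>L\<^esub> frac y t = frac (r \<otimes> y) t" if "r \<in> carrier R" "y \<in> carrier R" for r y
    using that t(1) by (simp add: frac_mult)
  have "carrier R \<subseteq> {x \<in> carrier R. \<exists>y\<in>carrier R. g x = frac y t}" (is "_ \<subseteq> ?D")
  proof (rule span)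
    show "B \<subseteq> ?D" using B(2) t(2) by auto
    \<comment> \<open>The value at zero is computed from semilinearity with the factor
      \<open>\<zero>\<close>, and then rewritten with denominator t.\<close>
    obtain a s where a: "g \<zero> = frac a s" "a \<in> carrier R" "s \<in> S"
      using L_cases[OF g_closed[OF zero_closed]] by metis
    have "g \<zero> = frac \<zero> \<one> \<otimes>\<^bsub>L\<^esub> g \<zero>"
      using g_mult[of \<zero> \<zero>] by (simp add: zero_pow_char)
    also have "\<dots> = frac \<zero> s" using a by (simp add: frac_mult)
    also have "\<dots> = frac \<zero> t" by (rule frac_eqI) (use a t(1) in simp_all)
    finally show "\<zero> \<in> ?D" by auto
    show "\<forall>x\<in>?D. \<forall>y\<in>?D. x \<oplus> y \<in> ?D"
      using t(1) by (auto simp: g_add frac_add_same)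
    show "\<forall>r\<in>carrier R. \<forall>x\<in>?D. r [^] (p ^ e) \<otimes> x \<in> ?D"
      by (auto simp: g_mult smul)
  qed
  then have "\<forall>x\<in>carrier R. \<exists>y\<in>carrier R. g x = frac y t" by auto
  \<comment> \<open>The numerators h are chosen pointwise, so h satisfies the linearity conditions
    only up to elements killed by some member of S.\<close>
  then obtain h where h: "\<And>x. x \<in> carrier R \<Longrightarrow> h x \<in> carrier R"
    "\<And>x. x \<in> carrier R \<Longrightarrow> g x = frac (h x) t"
    by metis
  \<comment> \<open>A single u kills all these ambiguities, so u h is a genuine Cartier linear map
    although h need not be one.\<close>
  obtain u where u: "u \<in> S" "\<And>v y. \<lbrakk>v \<in> S; y \<in> carrier R; v \<otimes> y = \<zero>\<rbrakk> \<Longrightarrow> u \<otimes> y = \<zero>"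
    using kernel_annihilator[OF noetherian_ring_axioms multiplicative_set_axioms] by blast
  have u_eq: "u \<otimes> y = u \<otimes> z" if yz: "frac y t = frac z t" "y \<in> carrier R" "z \<in> carrier R" for y z
  proof -
    obtain v where v: "v \<in> S" "v \<otimes> (y \<otimes> t) = v \<otimes> (z \<otimes> t)"
      using yz t(1) by (auto simp: frac_eq_iff)
    have "(v \<otimes> t) \<otimes> (y \<ominus> z) = v \<otimes> (y \<otimes> t) \<ominus> v \<otimes> (z \<otimes> t)"
      using v(1) t(1) yz by (simp add: minus_eq r_distr r_minus m_ac)
    also have "\<dots> = \<zero>" using v(2) v(1) t(1) yz by simp
    finally have "u \<otimes> (y \<ominus> z) = \<zero>"
      using v(1) t(1) yz by (intro u(2)[of "v \<otimes> t"]) auto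
    then have "u \<otimes> y \<ominus> u \<otimes> z = \<zero>"
      using u(1) yz by (simp add: minus_eq r_distr r_minus)
    then show ?thesis using u(1) yz by simp
  qed
  have "cartier_linear R p e (\<lambda>x. u \<otimes> h x)"
    unfolding cartier_linear_def
  proof (intro conjI ballI)
    show "(\<lambda>x. u \<otimes> h x) \<in> carrier R \<rightarrow> carrier R" using u(1) h(1) by auto
    fix x y assume x: "x \<in> carrier R" "y \<in> carrier R"
    have "frac (h (x \<oplus> y)) t = frac (h x \<oplus> h y) t"
      using x g_add[OF x] h t(1) by (simp add: frac_add_same)
    then have "u \<otimes> h (x \<oplus> y) = u \<otimes> (h x \<oplus> h y)" using x h(1) by (intro u_eq) auto
    then show "u \<otimes> h (x \<oplus> y) = u \<otimes> h x \<oplus> u \<otimes> h y" using x h(1) u(1) by (simp add: r_distr)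
    have "frac (h (x [^] (p ^ e) \<otimes> y)) t = frac (x \<otimes> h y) t"
      using x g_mult[OF x] h smul by simp
    then have "u \<otimes> h (x [^] (p ^ e) \<otimes> y) = u \<otimes> (x \<otimes> h y)" using x h(1) by (intro u_eq) auto
    then show "u \<otimes> h (x [^] (p ^ e) \<otimes> y) = x \<otimes> (u \<otimes> h y)" using x h(1) u(1) by (simp add: m_lcomm)
  qed
  \<comment> \<open>The fraction with numerator \<open>h d\<close> and denominator t equals 1, so v
    h(d) = v t for some v outside P. If u h(d) were in P, then so would be u v t, a product of
    elements outside P.\<close>
  moreover have "u \<otimes> h d \<notin> P"
  proof
    assume inP: "u \<otimes> h d \<in> P"
    have "frac (h d) t = frac \<one> \<one>" using h(2)[OF d] \<psi>d by (simp add: g_def one_L)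
    then obtain v where v: "v \<in> S" "v \<otimes> h d = v \<otimes> t"
      using t(1) h(1)[OF d] by (auto simp: frac_eq_iff)
    have "v \<otimes> (u \<otimes> h d) \<in> P" using inP Pc(4) v(1) by auto
    also have "v \<otimes> (u \<otimes> h d) = u \<otimes> (v \<otimes> t)"
      using v u(1) t(1) h(1)[OF d] by (simp add: m_lcomm)
    finally show False
      using S_mult[OF u(1) S_mult[OF v(1) t(1)]] by (simp add: S_def)
  qed
  ultimately show thesis using e that by blast
qed

end

section \<open>Test elements\<close>

context prime_char_cring
begin

text \<open>The value at \<open>\<one>\<close> does not grow with \<open>e\<close>, since \<open>\<theta> (c ^ (p - 2) * c ^ 2) = \<theta> (c ^ p * 1) = c * c\<close>.\<close>

lemma cartier_linear_iterate:
  assumes "cartier_linear R p 1 \<theta>" "\<theta> \<one> = c"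
  shows "\<exists>\<psi>. cartier_linear R p e \<psi> \<and> \<psi> \<one> = c \<otimes> c"
proof (induction e)
  case 0
  have c: "c \<in> carrier R" using cartier_linearD(1)[OF assms(1), of \<one>] assms(2) by simp
  \<comment> \<open>At level 0 multiplication by c^2 is taken rather than the identity, so that the
    value at \<open>\<one>\<close> is the same at every level.\<close>
  have "cartier_linear R p 0 (\<lambda>z. c \<otimes> c \<otimes> z)"
    using c by (auto simp: cartier_linear_def r_distr m_lcomm)
  then show ?case using c by (intro exI[of _ "\<lambda>z. c \<otimes> c \<otimes> z"]) simp
next
  case (Suc e)
  then obtain \<psi> where \<psi>: "cartier_linear R p e \<psi>" "\<psi> \<one> = c \<otimes> c" by auto
  have c: "c \<in> carrier R" using cartier_linearD(1)[OF assms(1), of \<one>] assms(2) by simp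
  obtain k where k: "p = Suc (Suc k)"
    using prime_ge_2_nat[OF prime_p] by (metis add_2_eq_Suc le_Suc_ex)
  have "c [^] k \<otimes> (c \<otimes> c) = c [^] (p ^ 1) \<otimes> \<one>"
    using c by (simp add: k m_assoc)
  then have "\<theta> (c [^] k \<otimes> \<psi> \<one>) = c \<otimes> c"
    using cartier_linearD(3)[OF assms(1) c one_closed] assms(2) \<psi>(2) by simp
  moreover have "cartier_linear R p (Suc e) (\<lambda>z. \<theta> (c [^] k \<otimes> \<psi> z))"
    using cartier_linear_comp[OF assms(1) \<psi>(1), of "c [^] k"] c by simp
  ultimately show ?case by blast
qed

text \<open>This is the image of evaluation at 1 on Hom(F^e_*R, R). For positive e it is the unit
  ideal exactly when the e-th Frobenius splits; as an ideal it can be tested prime by prime.\<close>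

lemma ideal_cartier_linear_one:
  "ideal {\<theta> \<one> | \<theta>. cartier_linear R p e \<theta>} R"
proof (rule ideal_by_closure)
  show "{\<theta> \<one> | \<theta>. cartier_linear R p e \<theta>} \<subseteq> carrier R"
    using cartier_linearD(1) by fastforce
  have "cartier_linear R p e (\<lambda>z. \<zero>)"
    by (auto simp: cartier_linear_def)
  then show "\<zero> \<in> {\<theta> \<one> | \<theta>. cartier_linear R p e \<theta>}" by force
  fix x assume "x \<in> {\<theta> \<one> | \<theta>. cartier_linear R p e \<theta>}"
  then obtain \<theta> where \<theta>: "x = \<theta> \<one>" "cartier_linear R p e \<theta>" by auto
  note T = cartier_linearD[OF \<theta>(2)]
  show "r \<otimes> x \<in> {\<theta> \<one> | \<theta>. cartier_linear R p e \<theta>}" if "r \<in> carrier R" for r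
  proof -
    have "cartier_linear R p e (\<lambda>z. r \<otimes> \<theta> z)"
      using that unfolding cartier_linear_def by (auto simp: T r_distr m_lcomm)
    then show ?thesis using \<theta>(1) by (intro CollectI exI[of _ "\<lambda>z. r \<otimes> \<theta> z"]) simp
  qed
  fix y assume "y \<in> {\<theta> \<one> | \<theta>. cartier_linear R p e \<theta>}"
  then obtain \<eta> where \<eta>: "y = \<eta> \<one>" "cartier_linear R p e \<eta>" by auto
  note E = cartier_linearD[OF \<eta>(2)]
  have "cartier_linear R p e (\<lambda>z. \<theta> z \<oplus> \<eta> z)"
    unfolding cartier_linear_def by (auto simp: T E r_distr a_ac)
  then show "x \<oplus> y \<in> {\<theta> \<one> | \<theta>. cartier_linear R p e \<theta>}" 
    using \<theta>(1) \<eta>(1) by (intro CollectI exI[of _ "\<lambda>z. \<theta> z \<oplus> \<eta> z"]) simp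
qed

text \<open>Precomposing with the e-th Frobenius F_*R -> F^(e+1)_*R keeps the value at 1. It brings
  maps whose level depends on the prime to the common level 1.\<close>

lemma cartier_linear_reduce:
  assumes "cartier_linear R p (Suc e) \<phi>"
  shows "cartier_linear R p 1 (\<lambda>z. \<phi> (z [^] (p ^ e)))"
  unfolding cartier_linear_def
proof (intro conjI ballI)
  note F = cartier_linearD[OF assms]
  show "(\<lambda>z. \<phi> (z [^] (p ^ e))) \<in> carrier R \<rightarrow> carrier R" using F(1) by auto
  fix x y assume x: "x \<in> carrier R" "y \<in> carrier R"
  show "\<phi> ((x \<oplus> y) [^] (p ^ e)) = \<phi> (x [^] (p ^ e)) \<oplus> \<phi> (y [^] (p ^ e))"
    using x by (simp add: pow_char_add F)
  show "\<phi> ((x [^] (p ^ 1) \<otimes> y) [^] (p ^ e)) = x \<otimes> \<phi> (y [^] (p ^ e))"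
    using F(3)[of x "y [^] (p ^ e)"] x by (simp add: nat_pow_distrib nat_pow_pow)
qed

end

context noetherian_prime_char
begin

text \<open>If \<open>R\<^sub>f\<close> is strongly F-regular, a power of \<open>f\<close> is a test element: given \<open>x \<in> A\<^sup>*\<close>, a
  power of \<open>f\<close> depending on \<open>x\<close> multiplies \<open>x\<^sup>q\<close> into the Frobenius power of \<open>A\<close> for all large
  \<open>q\<close>, and \<open>\<psi>\<close> extracts a \<open>q\<close>-th root at the uniform cost of \<open>c\<^sup>2\<close>.\<close>

lemma radical_test_ideal:
  assumes f: "f \<in> carrier R"
    and split: "\<And>P d. \<lbrakk>primeideal P R; f \<notin> P; d \<in> off_minimal_primes R\<rbrakk> \<Longrightarrow>
      \<exists>e>0. \<exists>\<phi>. cartier_linear R p e \<phi> \<and> \<phi> d \<notin> P"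
  shows "f \<in> ideal_radical R (test_ideal R p)"
proof -
  let ?B = "{\<theta> \<one> | \<theta>. cartier_linear R p 1 \<theta>}"
  have "f \<in> ideal_radical R ?B"
  proof (rule ccontr)
    assume "f \<notin> ideal_radical R ?B"
    then obtain P where P: "primeideal P R" "?B \<subseteq> P" "f \<notin> P"
      using non_radical_prime[OF ideal_cartier_linear_one f] by blast
    \<comment> \<open>Positivity of e matters here: only a map of positive level can be reduced to
      level 1.\<close>
    obtain e \<phi> where e: "e > 0" "cartier_linear R p e \<phi>" "\<phi> \<one> \<notin> P"
      using split[OF P(1,3) one_off_minimal_primes] by blast
    then obtain d where "e = Suc d" using gr0_conv_Suc by blast
    then have "cartier_linear R p 1 (\<lambda>z. \<phi> (z [^] (p ^ d)))"
      using cartier_linear_reduce e(2) by blast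
    then have "\<phi> (\<one> [^] (p ^ d)) \<in> ?B"
      by (intro CollectI exI[of _ "\<lambda>z. \<phi> (z [^] (p ^ d))"]) simp
    then show False using P(2) e(3) by auto
  qed
  then obtain k :: nat where "f [^] k \<in> ?B" by (auto simp: ideal_radical_def)
  \<comment> \<open>A positive exponent is arranged so that the powers c^(p^e) involve arbitrarily
    high powers of f.\<close>
  then have "f [^] Suc k \<in> ?B"
    using ideal_closed(5)[OF ideal_cartier_linear_one f] by simp
  then obtain \<theta> where \<theta>: "cartier_linear R p 1 \<theta>" "\<theta> \<one> = f [^] Suc k" by auto
  define c where "c = f [^] Suc k"
  have c: "c \<in> carrier R" using f by (simp add: c_def)
  have test: "c [^] (3::nat) \<otimes> x \<in> A" if A: "ideal A R" and x: "x \<in> tight_closure R p A" for A x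
  proof -
    have Ac: "A \<subseteq> carrier R" using ideal_closed(1)[OF A] .
    note F = ideal_closed[OF ideal_frobenius_power[OF Ac]]
    obtain d k0 where d: "x \<in> carrier R" "d \<in> off_minimal_primes R" "d \<in> carrier R"
      "\<forall>n\<ge>k0. d \<otimes> x [^] (p ^ n) \<in> frobenius_power R A (p ^ n)"
      using x by (rule tight_closureE) blast
    \<comment> \<open>The bound k0 is fixed once for all multipliers. Applying \<phi> to the
      relation at index e + n gives one at index n, so the new multiplier \<open>\<phi> d\<close>
      works from the same k0 on.\<close>
    let ?C = "{s \<in> carrier R. \<forall>n\<ge>k0. s \<otimes> x [^] (p ^ n) \<in> frobenius_power R A (p ^ n)}"
    have C: "ideal ?C R"
      using d(1) F by (intro ideal_by_closure) (auto simp: l_distr m_assoc)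
    have "f \<in> ideal_radical R ?C"
    proof (rule ccontr)
      assume "f \<notin> ideal_radical R ?C"
      then obtain P where P: "primeideal P R" "?C \<subseteq> P" "f \<notin> P"
        using non_radical_prime[OF C f] by blast
      obtain e \<phi> where e: "cartier_linear R p e \<phi>" "\<phi> d \<notin> P"
        using split[OF P(1,3) d(2)] by blast
      note E = cartier_linearD[OF e(1)]
      have "\<phi> d \<otimes> x [^] (p ^ n) \<in> frobenius_power R A (p ^ n)" if "n \<ge> k0" for n
      proof -
        have "d \<otimes> x [^] (p ^ (e + n)) \<in> frobenius_power R A (p ^ (e + n))"
          using d(4) that by simp
        then have "\<phi> (d \<otimes> x [^] (p ^ (e + n))) \<in> frobenius_power R A (p ^ n)"
          by (rule cartier_linear_frobenius_power[OF e(1) Ac])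
        also have "d \<otimes> x [^] (p ^ (e + n)) = (x [^] (p ^ n)) [^] (p ^ e) \<otimes> d"
          using d(1,3) by (simp add: nat_pow_pow power_add m_comm mult.commute)
        also have "\<phi> \<dots> = \<phi> d \<otimes> x [^] (p ^ n)"
          using E(1,3) d(1,3) by (simp add: m_comm)
        finally show ?thesis .
      qed
      then have "\<phi> d \<in> ?C" using E(1) d(3) by auto
      then show False using P(2) e(2) by auto
    qed
    then obtain N :: nat where N: "f [^] N \<in> ?C" by (auto simp: ideal_radical_def)
    \<comment> \<open>The summand N ensures that p^e exceeds N, so c^(p^e) is a multiple of f^N. The
      summand k0 puts e in the range where members of \<open>?C\<close> act as multipliers.\<close>
    define e where "e = N + k0"
    have "N \<le> e" by (simp add: e_def)
    also have "\<dots> < p ^ e" using prime_ge_2_nat[OF prime_p] by (intro power_gt_expt) simp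
    also have "\<dots> \<le> Suc k * p ^ e" by simp
    finally have "Suc k * p ^ e = N + (Suc k * p ^ e - N)" by simp
    then have "c [^] (p ^ e) = f [^] N \<otimes> f [^] (Suc k * p ^ e - N)"
      using f by (metis c_def nat_pow_mult nat_pow_pow)
    then have "c [^] (p ^ e) \<in> ?C" using ideal_closed(5)[OF C _ N] f by simp
    then have "c [^] (p ^ e) \<otimes> x [^] (p ^ e) \<in> frobenius_power R A (p ^ (e + 0))"
      by (simp add: e_def)
    moreover obtain \<psi> where \<psi>: "cartier_linear R p e \<psi>" "\<psi> \<one> = c \<otimes> c"
      using cartier_linear_iterate[OF \<theta>] c_def by blast
    ultimately have "\<psi> (c [^] (p ^ e) \<otimes> x [^] (p ^ e)) \<in> frobenius_power R A (p ^ 0)"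
      using cartier_linear_frobenius_power[OF \<psi>(1) Ac] by blast
    \<comment> \<open>The argument is the p^e-th power of c x. Its root contributes one factor c and
      the value at \<open>\<one>\<close> two more, whence the exponent 3.\<close>
    moreover have "\<psi> (c [^] (p ^ e) \<otimes> x [^] (p ^ e)) = (c \<otimes> x) \<otimes> (c \<otimes> c)"
      using cartier_linearD(3)[OF \<psi>(1), of "c \<otimes> x" \<one>] c d(1) \<psi>(2) by (simp add: nat_pow_distrib)
    moreover have "frobenius_power R A (p ^ 0) \<subseteq> A"
      using Ac by (subst frobenius_power_subset_iff[OF Ac A]) auto
    ultimately have "(c \<otimes> x) \<otimes> (c \<otimes> c) \<in> A" by auto
    also have "(c \<otimes> x) \<otimes> (c \<otimes> c) = c [^] (3::nat) \<otimes> x"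
      using c d(1) by (simp add: numeral_3_eq_3 m_ac)
    finally show ?thesis .
  qed
  have "f [^] (Suc k * 3) = c [^] (3::nat)" unfolding c_def nat_pow_pow[OF f] ..
  then have "f [^] (Suc k * 3) \<in> test_ideal R p"
    using test c by (auto simp: test_ideal_def colon_ideal_def)
  then show ?thesis using f by (auto simp: ideal_radical_def)
qed

end

section \<open>Local rings\<close>

context noetherian_cring
begin

lemma local_proper_ideal_subset:
  assumes "local_ring R \<mm>" "ideal I R" "I \<noteq> carrier R"
  shows "I \<subseteq> \<mm>"
  using proper_ideal_subset_maximalideal[OF assms(2,3)] assms(1)
  by (metis local_ring_def)

text \<open>Elements of \<open>\<mm>\<close> have a power in Q, and elements outside
  \<open>\<mm>\<close> are units that can be cancelled.\<close>

lemma primary_toI: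
  assumes "local_ring R \<mm>" "ideal Q R" "ideal_radical R Q = \<mm>"
  shows "primary_to R \<mm> Q"
proof -
  note Q = ideal_closed[OF assms(2)]
  have m: "maximalideal \<mm> R" using assms(1) by (simp add: local_ring_def)
  have "\<one> \<notin> \<mm>"
    using m ideal.one_imp_carrier maximalideal.axioms(1) maximalideal.I_notcarr by metis
  then have "Q \<noteq> carrier R" using assms(3) by (auto simp: ideal_radical_def)
  moreover have "x \<in> Q \<or> (\<exists>n::nat. y [^] n \<in> Q)"
    if xy: "x \<in> carrier R" "y \<in> carrier R" "x \<otimes> y \<in> Q" for x y
  proof (cases "y \<in> \<mm>")
    case True
    then show ?thesis using assms(3) by (auto simp: ideal_radical_def)
  next
    case False
    then have "PIdl y = carrier R"
      using local_proper_ideal_subset[OF assms(1) cgenideal_ideal[OF xy(2)]] cgenideal_self[OF xy(2)]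
      by blast
    then obtain z where z: "z \<in> carrier R" "\<one> = z \<otimes> y"
      unfolding cgenideal_def using one_closed by blast
    have "x = (z \<otimes> y) \<otimes> x" using xy(1) by (simp flip: z(2))
    also have "\<dots> = z \<otimes> (x \<otimes> y)" using z(1) xy(1,2) by (simp add: m_ac)
    finally show ?thesis using Q(4)[OF z(1) xy(3)] by simp
  qed
  ultimately show ?thesis
    using assms(2,3) by (auto simp: primary_to_def primary_ideal_def)
qed

end

section \<open>Frobenius powers of parameter ideals\<close>

context prime_char_cring
begin

lemma frobenius_power_subset:
  assumes "ideal A R"
  shows "frobenius_power R A (p ^ n) \<subseteq> A"
proof (subst frobenius_power_subset_iff)
  show "A \<subseteq> carrier R" using ideal_closed(1)[OF assms] .
  obtain m where m: "p ^ n = Suc m" using p_pow_pos[of n] gr0_conv_Suc by blast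
  show "\<forall>a\<in>A. a [^] (p ^ n) \<in> A"
    unfolding m using ideal_closed(1,4)[OF assms] by auto
qed (rule assms)

lemma ideal_radical_frobenius_power:
  assumes "ideal A R"
  shows "ideal_radical R (frobenius_power R A (p ^ n)) = ideal_radical R A"
proof
  show "ideal_radical R (frobenius_power R A (p ^ n)) \<subseteq> ideal_radical R A"
    using frobenius_power_subset[OF assms] by (auto simp: ideal_radical_def)
  show "ideal_radical R A \<subseteq> ideal_radical R (frobenius_power R A (p ^ n))"
  proof
    fix x assume "x \<in> ideal_radical R A"
    then obtain k :: nat where x: "x \<in> carrier R" "x [^] k \<in> A" by (auto simp: ideal_radical_def)
    then have "(x [^] k) [^] (p ^ n) \<in> frobenius_power R A (p ^ n)"
      using ideal_closed(1)[OF assms] by (intro pow_in_frobenius_power)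
    then show "x \<in> ideal_radical R (frobenius_power R A (p ^ n))"
      using x(1) by (auto simp: ideal_radical_def nat_pow_pow)
  qed
qed

end

context noetherian_prime_char
begin

lemma system_of_parameters_pow:
  assumes "local_ring R \<mm>" "system_of_parameters R \<mm> xs"
  shows "system_of_parameters R \<mm> (map (\<lambda>x. x [^] (p ^ n)) xs)"
proof -
  have sp: "set xs \<subseteq> \<mm>" "enat (length xs) = krull_dim R" "primary_to R \<mm> (Idl (set xs))"
    using assms(2) by (auto simp: system_of_parameters_def)
  have m: "ideal \<mm> R"
    using assms(1) by (simp add: local_ring_def maximalideal.axioms(1))
  have xs: "set xs \<subseteq> carrier R" using sp(1) ideal_closed(1)[OF m] by auto
  have I: "Idl (set (map (\<lambda>x. x [^] (p ^ n)) xs)) = frobenius_power R (Idl (set xs)) (p ^ n)"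
    using frobenius_power_genideal[OF xs] by simp
  have gi: "ideal (Idl (set xs)) R" using xs by (rule genideal_ideal)
  have "primary_to R \<mm> (frobenius_power R (Idl (set xs)) (p ^ n))"
    using sp(3) ideal_radical_frobenius_power[OF gi] ideal_closed(1)[OF gi]
    by (intro primary_toI[OF assms(1)] ideal_frobenius_power) (auto simp: primary_to_def)
  moreover have "x [^] (p ^ n) \<in> \<mm>" if "x \<in> \<mm>" for x
    using frobenius_power_subset[OF m] pow_in_frobenius_power[OF ideal_closed(1)[OF m] that] by blast
  then have "set (map (\<lambda>x. x [^] (p ^ n)) xs) \<subseteq> \<mm>" using sp(1) by auto
  ultimately show ?thesis
    using sp(2) unfolding system_of_parameters_def I by simp
qed

text \<open>F-rationality speaks about parameter ideals only, so the Frobenius powers of J must be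
  of this kind as well. Raising a whole system of parameters to the p^n-th power preserves its
  length and the radical.\<close>

lemma parameter_ideal_frobenius_power:
  assumes "local_ring R \<mm>" "parameter_ideal R \<mm> Q"
  shows "parameter_ideal R \<mm> (frobenius_power R Q (p ^ n))"
proof -
  obtain xs ys where xs: "system_of_parameters R \<mm> (xs @ ys)" "Q = Idl (set xs)"
    using assms(2) by (auto simp: parameter_ideal_def)
  have "ideal \<mm> R"
    using assms(1) by (simp add: local_ring_def maximalideal.axioms(1))
  then have "set xs \<subseteq> carrier R"
    using xs(1) ideal_closed(1) by (auto simp: system_of_parameters_def)
  then have "frobenius_power R Q (p ^ n) = Idl (set (map (\<lambda>x. x [^] (p ^ n)) xs))"
    using frobenius_power_genideal xs(2) by simp
  then show ?thesis
    using system_of_parameters_pow[OF assms(1) xs(1), of n] by (auto simp: parameter_ideal_def)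
qed

end

section \<open>Thresholds\<close>

lemma tendsto_const_over_power:
  assumes "p \<ge> 2"
  shows "(\<lambda>n. K / real (p ^ n)) \<longlonglongrightarrow> 0"
proof -
  have "(\<lambda>n. K * inverse (real p ^ n)) \<longlonglongrightarrow> K * 0"
    using assms by (intro tendsto_mult tendsto_const LIMSEQ_inverse_realpow_zero) simp
  then show ?thesis by (simp add: divide_inverse)
qed

lemma convergent_scaled:
  fixes u :: "nat \<Rightarrow> nat"
  assumes "p \<ge> 2" and step: "\<And>n. u (Suc n) \<le> p * (u n + C)"
  shows "convergent (\<lambda>n. real (u n) / real (p ^ n))"
proof -
  text \<open>The correction \<open>2 C / p\<^sup>n\<close> absorbs the error of each step since \<open>C + 2 C / p \<le> 2 C\<close>.\<close>
  define b where "b n = (real (u n) + 2 * real C) / real (p ^ n)" for n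
  have "b (Suc n) \<le> b n" for n
  proof -
    have "2 * real C \<le> real p * real C" using assms(1) by (intro mult_right_mono) auto
    moreover have "real (u (Suc n)) \<le> real p * (real (u n) + real C)"
      using step[of n] by (metis of_nat_add of_nat_le_iff of_nat_mult)
    ultimately have "real (u (Suc n)) + 2 * real C \<le> real p * (real (u n) + 2 * real C)"
      by (simp add: algebra_simps)
    then have "b (Suc n) \<le> (real p * (real (u n) + 2 * real C)) / real (p ^ Suc n)"
      unfolding b_def by (intro divide_right_mono) auto
    also have "\<dots> = b n" using assms(1) by (simp add: b_def)
    finally show ?thesis .
  qed
  then have "decseq b" by (rule decseq_SucI)
  then obtain l where "b \<longlonglongrightarrow> l"
    using decseq_convergent[of b 0] by (auto simp: b_def)
  then have "(\<lambda>n. b n - (2 * real C) / real (p ^ n)) \<longlonglongrightarrow> l - 0"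
    by (intro tendsto_diff tendsto_const_over_power assms(1))
  then show ?thesis by (auto simp: b_def add_divide_distrib convergent_def)
qed

lemma tendsto_bounded_perturbation:
  fixes s u :: "nat \<Rightarrow> real"
  assumes "p \<ge> 2" "(\<lambda>n. u n / real (p ^ n)) \<longlonglongrightarrow> l" "\<And>n. \<bar>s n - u n\<bar> \<le> K"
  shows "(\<lambda>n. s n / real (p ^ n)) \<longlonglongrightarrow> l"
proof -
  have "(\<lambda>n. (s n - u n) / real (p ^ n)) \<longlonglongrightarrow> 0"
  proof (rule tendsto_0_le[OF tendsto_const_over_power[OF assms(1), of K], where K = 1])
    have "0 \<le> K" using assms(3)[of 0] by linarith
    then show "\<forall>\<^sub>F n in sequentially. norm ((s n - u n) / real (p ^ n)) \<le> norm (K / real (p ^ n)) * 1"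
      using assms(3) by (intro always_eventually allI) (simp add: abs_divide divide_right_mono)
  qed
  from tendsto_add[OF this assms(2)] show ?thesis by (simp add: diff_divide_distrib)
qed

text \<open>Here u and v are least successful exponents, and su and sv are the \<open>Sup\<close>
  and \<open>Max\<close> of the failing ones, which differ from them by a bounded amount.\<close>

lemma lim_scaled_eq:
  fixes u v r su sv :: "nat \<Rightarrow> nat"
  assumes p: "p \<ge> 2"
    and u: "\<And>n. u (Suc n) \<le> p * (u n + C)" and v: "\<And>n. v (Suc n) \<le> p * (v n + C)"
    and vu: "\<And>n. v n \<le> u n"
    and inf: "infinite {n. u n \<le> r n + v n}"
    and r: "(\<lambda>n. real (r n) / real (p ^ n)) \<longlonglongrightarrow> 0"
    and su: "\<And>n. \<bar>real (su n) - real (u n)\<bar> \<le> K" and sv: "\<And>n. \<bar>real (sv n) - real (v n)\<bar> \<le> K"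
  shows "lim (\<lambda>n. real (su n) / real (p ^ n)) = lim (\<lambda>n. real (sv n) / real (p ^ n))"
proof -
  obtain a where a: "(\<lambda>n. real (u n) / real (p ^ n)) \<longlonglongrightarrow> a"
    using convergent_scaled[of p u C, OF p u] by (auto simp: convergent_def)
  obtain b where b: "(\<lambda>n. real (v n) / real (p ^ n)) \<longlonglongrightarrow> b"
    using convergent_scaled[of p v C, OF p v] by (auto simp: convergent_def)
  have "b \<le> a"
    using vu by (intro LIMSEQ_le[OF b a]) (auto intro!: divide_right_mono)
  \<comment> \<open>If b < a, the scaled difference u - v - r has a positive limit and is eventually
    positive, which fails at an index from the infinite set.\<close>
  moreover have "a \<le> b"
  proof (rule ccontr)
    assume "\<not> a \<le> b"
    moreover have "(\<lambda>n. real (u n) / real (p ^ n) - real (v n) / real (p ^ n) - real (r n) / real (p ^ n))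
      \<longlonglongrightarrow> a - b - 0"
      by (intro tendsto_diff a b r)
    ultimately have "\<forall>\<^sub>F n in sequentially.
      0 < real (u n) / real (p ^ n) - real (v n) / real (p ^ n) - real (r n) / real (p ^ n)"
      by (intro order_tendstoD(1)) auto
    then obtain n0 where n0: "\<And>n. n \<ge> n0 \<Longrightarrow>
      0 < real (u n) / real (p ^ n) - real (v n) / real (p ^ n) - real (r n) / real (p ^ n)"
      by (auto simp: eventually_sequentially)
    obtain n where n: "n \<ge> n0" "u n \<le> r n + v n"
      using inf unfolding infinite_nat_iff_unbounded_le by blast
    have "real (u n) - real (v n) - real (r n) \<le> 0" using n(2) by linarith
    then have "(real (u n) - real (v n) - real (r n)) / real (p ^ n) \<le> 0"
      by (intro divide_nonpos_nonneg) auto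
    then show False using n0[OF n(1)] by (simp add: diff_divide_distrib)
  qed
  ultimately have "a = b" by simp
  then show ?thesis
    using limI[OF tendsto_bounded_perturbation[OF p a su]]
      limI[OF tendsto_bounded_perturbation[OF p b sv]] by simp
qed

text \<open>The largest failing exponent is one below the least successful one. For n = 0 the value
  is \<open>Sup {}\<close>, which is 0 on the naturals.\<close>

lemma abs_Sup_lessThan_diff: "\<bar>real (Sup {..<n::nat}) - real n\<bar> \<le> 1"
proof (cases n)
  case (Suc m)
  then have "Sup {..<n} = m" by (simp add: lessThan_Suc_atMost)
  then show ?thesis using Suc by simp
qed simp

text \<open>\<^term>\<open>Max {}\<close> is an unspecified number.\<close>

lemma abs_Max_lessThan_diff: "\<bar>real (Max {..<n::nat}) - real n\<bar> \<le> 1 + real (Max {} :: nat)"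
proof (cases n)
  case (Suc m)
  have "Max {..m} = m" by (intro Max_eqI) auto
  then have "Max {..<n} = m" using Suc by (simp add: lessThan_Suc_atMost)
  then show ?thesis using Suc by simp
qed simp

section \<open>Comparison of the two thresholds\<close>

context noetherian_prime_char
begin

lemma not_subset_exponents:
  assumes "ideal I R" "ideal_power R I N \<subseteq> T"
  shows "{t. \<not> ideal_power R I t \<subseteq> T} = {..<LEAST t. ideal_power R I t \<subseteq> T}"
proof -
  have "ideal_power R I (LEAST t. ideal_power R I t \<subseteq> T) \<subseteq> T"
    using assms(2) by (rule LeastI)
  then have "ideal_power R I t \<subseteq> T" if "(LEAST t. ideal_power R I t \<subseteq> T) \<le> t" for t
    using ideal_power_antimono[OF assms(1) that] by blast
  moreover have "\<not> ideal_power R I t \<subseteq> T" if "t < (LEAST t. ideal_power R I t \<subseteq> T)" for t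
    using that by (rule not_less_Least)
  ultimately show ?thesis
    by (metis (no_types, lifting) Collect_cong lessThan_def not_le)
qed

lemma finite_generators:
  assumes "ideal I R"
  obtains G where "finite G" "G \<subseteq> carrier R" "I = Idl G"
  using finetely_gen[OF assms] by blast

text \<open>All five cases reduce to this criterion. The inclusion of I in the radical of J makes
  both least exponents exist.\<close>

lemma thresholds_eqI:
  assumes I: "ideal I R" and J: "ideal J R" and IJ: "I \<subseteq> ideal_radical R J"
    and inf: "infinite {n. ideal_power R I (r n) \<subseteq> colon_ideal R (frobenius_power R J (p ^ n))
      (tight_closure R p (frobenius_power R J (p ^ n)))}"
    and r: "(\<lambda>n. real (r n) / real (p ^ n)) \<longlonglongrightarrow> 0"
  shows "F_threshold R p J I = F_threshold_tight R p I J"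
proof -
  obtain G where G: "finite G" "G \<subseteq> carrier R" "I = Idl G"
    using finite_generators[OF I] by blast
  have Jc: "J \<subseteq> carrier R" using ideal_closed(1)[OF J] .
  let ?T = "\<lambda>n. frobenius_power R J (p ^ n)"
  let ?S = "\<lambda>n. tight_closure R p (?T n)"
  have T: "ideal (?T n) R" for n using Jc by (rule ideal_frobenius_power)
  have S: "ideal (?S n) R" for n by (intro ideal_tight_closure T)
  have TS: "?T n \<subseteq> ?S n" for n
    by (intro subset_tight_closure ideal_closed(1)[OF T])
  define u where "u n = (LEAST t. ideal_power R I t \<subseteq> ?T n)" for n
  define v where "v n = (LEAST t. ideal_power R I t \<subseteq> ?S n)" for n
  have ex: "\<exists>N. ideal_power R I N \<subseteq> ?T n" for n
  proof -
    have "G \<subseteq> ideal_radical R (?T n)"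
      using IJ genideal_self[OF G(2)] ideal_radical_frobenius_power[OF J] G(3) by auto
    then show ?thesis
      using genideal_power_subset_of_radical[OF G(1,2) T] G(3) by metis
  qed
  have uT: "ideal_power R I (u n) \<subseteq> ?T n" for n
    unfolding u_def using ex[of n] by (rule LeastI_ex)
  have vS: "ideal_power R I (v n) \<subseteq> ?S n" for n
    unfolding v_def using ex[of n] TS[of n] by (intro LeastI_ex[of "\<lambda>t. ideal_power R I t \<subseteq> ?S n"]) blast
  \<comment> \<open>A will be the Frobenius power \<open>?T n\<close> for u and its tight closure
    for v. The additive constant \<open>card G\<close> depends on neither n nor A.\<close>
  have step: "ideal_power R I (p * (t + card G)) \<subseteq> frobenius_power R A (p ^ 1)"
    if "ideal_power R I t \<subseteq> A" "A \<subseteq> carrier R" for t A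
    using ideal_power_subset_frobenius_power[OF G(1,2), of "p ^ 1" t]
      frobenius_power_mono[OF that, of "p ^ 1"] p_pow_pos[of 1] G(3) by auto
  have "u (Suc n) \<le> p * (u n + card G)" for n
    unfolding u_def[of "Suc n"]
    using step[OF uT ideal_closed(1)[OF T], of n] frobenius_power_frobenius_power[OF Jc, of n 1]
    by (intro Least_le) simp
  \<comment> \<open>The p-th Frobenius power of \<open>?S n\<close> lies in
    \<open>?S (Suc n)\<close>, so the tight exponents obey the same recursion.\<close>
  moreover have "v (Suc n) \<le> p * (v n + card G)" for n
    unfolding v_def[of "Suc n"]
    using step[OF vS ideal_closed(1)[OF S], of n] frobenius_power_tight_closure[OF T, of n 1]
      frobenius_power_frobenius_power[OF Jc, of n 1]
    by (intro Least_le) simp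
  moreover have "v n \<le> u n" for n
    unfolding v_def using uT TS by (intro Least_le) blast
  moreover have "infinite {n. u n \<le> r n + v n}"
  proof (rule infinite_super[OF _ inf], clarify)
    fix n assume "ideal_power R I (r n) \<subseteq> colon_ideal R (?T n) (?S n)"
    then have "ideal_power R I (r n + v n) \<subseteq> ?T n"
      by (rule ideal_power_colon[OF I T vS])
    then show "u n \<le> r n + v n" unfolding u_def by (rule Least_le)
  qed
  moreover have "{t. \<not> ideal_power R I t \<subseteq> ?T n} = {..<u n}"
    and "{t. \<not> ideal_power R I t \<subseteq> ?S n} = {..<v n}" for n
    unfolding u_def v_def using not_subset_exponents[OF I] uT vS by blast+
  \<comment> \<open>The case \<open>v n = 0\<close> is covered as well: the set of failing exponents
    is then empty and its \<open>Max\<close> is an arbitrary fixed number. It enters the constant K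
    and disappears after scaling.\<close>
  ultimately show ?thesis
    unfolding F_threshold_def F_threshold_tight_def
    using prime_ge_2_nat[OF prime_p] r
    by (intro lim_scaled_eq[where u = u and v = v and r = r and C = "card G"
          and K = "1 + real (Max {} :: nat)"])
      (auto intro: abs_Max_lessThan_diff order_trans[OF abs_Sup_lessThan_diff])
qed

lemma ideal_test_ideal: "ideal (test_ideal R p) R"
  unfolding test_ideal_def
proof (rule i_Intersect)
  show "{colon_ideal R A (tight_closure R p A) |A. ideal A R} \<noteq> {}"
    using zeroideal by blast
  show "ideal K R" if "K \<in> {colon_ideal R A (tight_closure R p A) |A. ideal A R}" for K
    using that ideal_closed(1)[OF ideal_tight_closure] by (auto intro: ideal_colon)
qed

text \<open>As I is finitely generated, one power of it lies in the test ideal. That ideal lies in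
  every colon ideal of the criterion, so a constant r works for all n.\<close>

lemma thresholds_eq_of_radical_test_ideal:
  assumes I: "ideal I R" and J: "ideal J R" and "I \<subseteq> ideal_radical R J"
    and It: "I \<subseteq> ideal_radical R (test_ideal R p)"
  shows "F_threshold R p J I = F_threshold_tight R p I J"
proof -
  obtain G where G: "finite G" "G \<subseteq> carrier R" "I = Idl G"
    using finite_generators[OF I] by blast
  obtain N where N: "ideal_power R I N \<subseteq> test_ideal R p"
    using genideal_power_subset_of_radical[OF G(1,2) ideal_test_ideal] It genideal_self[OF G(2)] G(3)
    by blast
  have "ideal_power R I N \<subseteq> colon_ideal R (frobenius_power R J (p ^ n))
      (tight_closure R p (frobenius_power R J (p ^ n)))" for n
    using N ideal_frobenius_power[OF ideal_closed(1)[OF J]] by (auto simp: test_ideal_def)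
  then show ?thesis
    using prime_ge_2_nat[OF prime_p]
    by (intro thresholds_eqI[OF assms(1-3), of "\<lambda>_. N"] tendsto_const_over_power) auto
qed

end

theorem theorem7p18:
  fixes R :: "('a, 'b) ring_scheme" and \<mm> I J :: "'a set" and p :: nat
  assumes "noetherian_ring R" and "local_ring R \<mm>"
    and "Factorial_Ring.prime p" and "has_characteristic R p" and "F_finite R p"
    and "ideal I R" and "I \<noteq> carrier R"
    and "ideal J R" and "primary_to R \<mm> J"
    and "(\<exists>r' :: nat \<Rightarrow> nat.
            (\<forall>n. r' n > 0) \<and>
            infinite {n. ideal_power R I (r' n) \<subseteq>
              colon_ideal R (frobenius_power R J (p ^ n))
                (tight_closure R p (frobenius_power R J (p ^ n)))} \<and>
            (\<lambda>n. real (r' n) / real (p ^ n)) \<longlonglongrightarrow> 0)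
       \<or> (\<exists>n0 :: nat. infinite {q. (\<exists>e. q = p ^ e) \<and>
            ideal_power R I n0 \<subseteq>
              colon_ideal R (frobenius_power R J q) (tight_closure R p (frobenius_power R J q))})
       \<or> (F_rational R \<mm> p \<and> parameter_ideal R \<mm> J)
       \<or> I \<subseteq> ideal_radical R (test_ideal R p)
       \<or> strongly_F_regular_on_punctured_spectrum R \<mm> p"
  shows "F_threshold R p J I = F_threshold_tight R p I J"
proof -
  interpret F_finite_noetherian R p
    using assms(1-5)
    by (intro F_finite_noetherian.intro noetherian_prime_char.intro noetherian_cring.intro
        prime_char_cring.intro prime_char_cring_axioms.intro F_finite_noetherian_axioms.intro)
      (auto simp: local_ring_def)
  have Im: "I \<subseteq> \<mm>" using local_proper_ideal_subset assms(2,6,7) by blast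
  have IJ: "I \<subseteq> ideal_radical R J" using Im assms(9) by (simp add: primary_to_def)
  have const: "(\<lambda>n. real N / real (p ^ n)) \<longlonglongrightarrow> 0" for N
    by (rule tendsto_const_over_power[OF prime_ge_2_nat[OF prime_p]])
  let ?c = "\<lambda>q. colon_ideal R (frobenius_power R J q) (tight_closure R p (frobenius_power R J q))"
  note main = thresholds_eqI[OF assms(6,8) IJ]
  from assms(10) show ?thesis
  proof (elim disjE exE conjE)
    fix r' :: "nat \<Rightarrow> nat"
    assume "infinite {n. ideal_power R I (r' n) \<subseteq> ?c (p ^ n)}"
      "(\<lambda>n. real (r' n) / real (p ^ n)) \<longlonglongrightarrow> 0"
    then show ?thesis by (rule main)
  next
    fix n0 assume "infinite {q. (\<exists>e. q = p ^ e) \<and> ideal_power R I n0 \<subseteq> ?c q}"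
    \<comment> \<open>The set of admissible q is the image of the set of admissible n, so infinitely
      many q force infinitely many n.\<close>
    moreover have "{q. (\<exists>e. q = p ^ e) \<and> ideal_power R I n0 \<subseteq> ?c q} =
      (\<lambda>n. p ^ n) ` {n. ideal_power R I n0 \<subseteq> ?c (p ^ n)}"
      by auto
    ultimately have "infinite {n. ideal_power R I n0 \<subseteq> ?c (p ^ n)}"
      using finite_imageI by metis
    then show ?thesis by (rule main[where r = "\<lambda>_. n0"]) (rule const)
  next
    assume rational: "F_rational R \<mm> p" "parameter_ideal R \<mm> J"
    have "tight_closure R p (frobenius_power R J (p ^ n)) = frobenius_power R J (p ^ n)" for n
      using parameter_ideal_frobenius_power[OF assms(2) rational(2)] rational(1)
      unfolding F_rational_def by metis
    moreover have "colon_ideal R (frobenius_power R J q) (frobenius_power R J q) = carrier R" for q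
      using ideal_closed(4)[OF ideal_frobenius_power[OF ideal_closed(1)[OF assms(8)]]]
      by (auto simp: colon_ideal_def)
    \<comment> \<open>All the colon ideals are the whole ring, so already I^0 = R lies in them and r
      = 0 is admissible.\<close>
    ultimately have "infinite {n. ideal_power R I 0 \<subseteq> ?c (p ^ n)}" by simp
    then show ?thesis by (rule main[where r = "\<lambda>_. 0"]) (rule const)
  next
    assume "I \<subseteq> ideal_radical R (test_ideal R p)"
    then show ?thesis by (rule thresholds_eq_of_radical_test_ideal[OF assms(6,8) IJ])
  next
    assume regular: "strongly_F_regular_on_punctured_spectrum R \<mm> p"
    \<comment> \<open>A prime missing f differs from \<open>\<mm>\<close>, so the punctured spectrum
      contains every prime at which \<open>radical_test_ideal\<close> asks for a map.\<close>
    have "f \<in> ideal_radical R (test_ideal R p)" if f: "f \<in> \<mm>" for f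
    proof (rule radical_test_ideal)
      show "f \<in> carrier R" using f assms(9) by (auto simp: primary_to_def ideal_radical_def)
      fix P d assume P: "primeideal P R" "f \<notin> P" and d: "d \<in> off_minimal_primes R"
      then have "strongly_F_regular (localization_at R P) p"
        using regular f unfolding strongly_F_regular_on_punctured_spectrum_def by blast
      then show "\<exists>e>0. \<exists>\<phi>. cartier_linear R p e \<phi> \<and> \<phi> d \<notin> P"
        using strongly_F_regular_localization[OF P(1) _ d] by metis
    qed
    then show ?thesis
      using Im by (intro thresholds_eq_of_radical_test_ideal[OF assms(6,8) IJ]) blast
  qed
qed

end
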